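(* Let $\varphi:\mathcal{U}\subseteq\mathbb{R}^n\to\mathbb{R}$ be twice continuously differentiable on the open set $\mathcal{U}$ and suppose $\varphi$ can be written as a codelist with $t\in\mathbb{N}$ operations. Let $\mathcal{B}=[\underline{x}_1,\overline{x}_1]\times\cdots\times[\underline{x}_n,\overline{x}_n]\subset\mathcal{U}$ be an arbitrary closed hyperrectangle. Let $[\varphi]\subset\mathbb{R}$, $[\nabla\varphi]\subset\mathbb{R}^n$ and $[\lambda_\varphi]\subset\mathbb{R}$ be the output of the sparse algorithm (Algorithm S, described in the context) for $\varphi$ and $\mathcal{B}$. Then for all $x\in\mathcal{B}$ $$\varphi(x)\in[\varphi],\qquad \nabla\varphi(x)\in[\nabla\varphi],\qquad [\lambda_{\min}(\nabla^2\varphi(x)),\lambda_{\max}(\nabla^2\varphi(x))]\subseteq[\lambda_\varphi].$$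
   Context: **Notation.** $\mathcal{N}=\{1,\dots,n\}$; for $\mathcal{J}\subseteq\mathcal{N}$, $\mathcal{J}^c=\mathcal{N}\setminus\mathcal{J}$ and $|\mathcal{J}|$ is the cardinality. $\subsetneq$ is strict inclusion. $\lambda_{\min},\lambda_{\max}$ are the smallest and largest eigenvalue of a symmetric matrix. $e_k$ is the $k$-th unit vector. $[a]=[\underline{a},\overline{a}]$ denotes a real interval, or a hyperrectangle $[\underline{a}_1,\overline{a}_1]\times\cdots\times[\underline{a}_m,\overline{a}_m]$. For a hyperrectangle $[\nabla y]\subset\mathbb{R}^n$ and nonempty $\mathcal{J}=\{j_1<\dots<j_m\}\subseteq\mathcal{N}$, $[\nabla_{\mathcal{J}}y]\subset\mathbb{R}^m$ is the hyperrectangle of the components $j_1,\dots,j_m$. **Interval arithmetic.** $[a]+[b]=[\underline a+\underline b,\overline a+\overline b]$; $[a][b]=[\min P,\max P]$ with $P=\{\underline a\,\underline b,\underline a\,\overline b,\overline a\,\underline b,\overline a\,\overline b\}$; $1/[a]=[1/\overline a,1/\underline a]$ (requires $0\notin[a]$); $[a]^0=[1,1]$ and, for $m\ge1$, $[a]^m=[\underline a^m,\overline a^m]$ if $\underline a>0$ or $m$ odd, $[\overline a^m,\underline a^m]$ if $\overline a<0$ and $m$ even, $[0,\max\{\underline a^m,\overline a^m\}]$ otherwise; $\sqrt{[a]}=[\sqrt{\underline a},\sqrt{\overline a}]$ (requires $\underline a\ge0$); $\exp([a])=[\exp\underline a,\exp\overline a]$; $\ln([a])=[\ln\underline a,\ln\overline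 a]$ (requires $\underline a>0$); $[a]+c=[\underline a+c,\overline a+c]$; $c[a]=[c\underline a,c\overline a]$ if $c\ge0$, $[c\overline a,c\underline a]$ otherwise; $-[a]=(-1)[a]$, $[a]-[b]=[a]+(-1)[b]$. For hyperrectangles, operations (including multiplication by an interval) are componentwise. All interval operations used are assumed to be well defined (the stated restrictions hold). **Interval operators.** For hyperrectangles $[a],[b]\subset\mathbb{R}^m$: $[\Lambda_s([a])]=[a]^2$ if $m=1$, and $[0,\sum_{i=1}^m\max\{\underline a_i^2,\overline a_i^2\}]$ otherwise; $[\Lambda_t([a],[b])]=2[a][b]$ if $m=1$, and $[-\beta,\beta]+\sum_{i=1}^m[a_i][b_i]$ otherwise, where $\beta=\sqrt{(\sum_i\max\{\underline a_i^2,\overline a_i^2\})(\sum_i\max\{\underline b_i^2,\overline b_i^2\})}$. For real intervals: $[\Lambda_r([a],[b])]=[\min\{\underline a,\underline b\},\max\{\overline a,\overline b\}]$ and $[\Lambda_\star([a],[b],[c])]=\frac12\big[\underline a+\underline b-\sqrt{(\underline a-\underline b)^2+d},\ \overline a+\overline b+\sqrt{(\overline a-\overline b)^2+d}\big]$ with $d=4\max\{\underline c^2,\overline c^2\}$. **Codelist.** $\varphi$ can be written as a codelist with $t$ operations if on $\mathcal{U}$: $y_k=x_k$ for $k=1,\dots,n$; for $k=n+1,\dots,n+t$, $y_k$ is obtained from earlier $y_i$ (and $y_j$), $i,j<k$, by one of the operations: add $y_k=y_i+y_j$; mul $y_k=y_iy_j$; powNat $y_k=y_i^m$ ($m\ge2$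 natural); oneOver $y_k=1/y_i$; sqrt $y_k=\sqrt{y_i}$; exp $y_k=\exp(y_i)$; ln $y_k=\ln(y_i)$; addC $y_k=y_i+c$; mulByC $y_k=c\,y_i$ ($c\in\mathbb{R}$ constant); and $\varphi=y_{n+t}$. **Algorithm S.** *Step 1.* For $k=1,\dots,n$: $\mathcal{I}_k=\mathcal{N}\setminus\{k\}$, $\mathcal{L}_k=\mathcal{N}$, $[y_k]=[\underline x_k,\overline x_k]$, $[\nabla y_k]=[e_k,e_k]$, $[\lambda_k^\dagger]=[0,0]$. *Step 2.* For $k=n+1,\dots,n+t$: (a) Index sets: add: $\mathcal{I}_k=\mathcal{I}_i\cap\mathcal{I}_j$, $\mathcal{L}_k=\mathcal{L}_i\cap\mathcal{L}_j$; mul: $\mathcal{I}_k=\mathcal{L}_k=\mathcal{I}_i\cap\mathcal{I}_j$; powNat, oneOver, sqrt, exp, ln: $\mathcal{I}_k=\mathcal{L}_k=\mathcal{I}_i$; addC, mulByC: $\mathcal{I}_k=\mathcal{I}_i$, $\mathcal{L}_k=\mathcal{L}_i$. (b) $[y_k]$ and $[\nabla y_k]$: add: $[y_i]+[y_j]$, $[\nabla y_i]+[\nabla y_j]$; mul: $[y_i][y_j]$, $[y_j][\nabla y_i]+[y_i][\nabla y_j]$; powNat: $[y_i]^m$, $m[y_i]^{m-1}[\nabla y_i]$; oneOver: $1/[y_i]$, $-[y_k]^2[\nabla y_i]$; sqrt: $\sqrt{[y_i]}$, $(1/(2[y_k]))[\nabla y_i]$; exp: $\exp([y_i])$, $[y_k][\nabla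 y_i]$; ln: $\ln([y_i])$, $(1/[y_i])[\nabla y_i]$; addC: $[y_i]+c$, $[\nabla y_i]$; mulByC: $c[y_i]$, $c[\nabla y_i]$. (c) $[\lambda_k^\dagger]$, with $[\lambda_{i,0}]=[\min\{\underline\lambda_i^\dagger,0\},\max\{\overline\lambda_i^\dagger,0\}]$, likewise $[\lambda_{j,0}]$; $\mathcal{L}_\cup=\mathcal{L}_i\cup\mathcal{L}_j$, $\mathcal{L}_\cap=\mathcal{L}_i\cap\mathcal{L}_j$; $[\lambda_t]=[\Lambda_t([\nabla_{\mathcal{L}_k^c}y_i],[\nabla_{\mathcal{L}_k^c}y_j])]$; $[\Lambda_s]$ short for $[\Lambda_s([\nabla_{\mathcal{L}_k^c}y_i])]$; $[\gamma]=[\nabla_{\mathcal{I}_i^c}y_i][\nabla_{\mathcal{I}_j^c}y_j]$; condition $C_\star$: $\mathcal{I}_i\cup\mathcal{I}_j=\mathcal{N}$ and $|\mathcal{I}_i|=|\mathcal{I}_j|=n-1$. add: - $[0,0]$ if $\mathcal{L}_i=\mathcal{L}_j=\mathcal{N}$; - $[\lambda_i^\dagger]$ if $\mathcal{L}_i\subsetneq\mathcal{N}=\mathcal{L}_j$; - $[\lambda_j^\dagger]$ if $\mathcal{L}_j\subsetneq\mathcal{N}=\mathcal{L}_i$; - $[\Lambda_r([\lambda_i^\dagger],[\lambda_j^\dagger])]$ if $\mathcal{L}_i,\mathcal{L}_j\subsetneq\mathcal{N}$, $\mathcal{L}_\cup=\mathcal{N}$; - and if $\mathcal{L}_\cup\subsetneq\mathcal{N}$: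 $[\lambda_i^\dagger]+[\lambda_j^\dagger]$ if $\mathcal{L}_i=\mathcal{L}_j$; $[\lambda_i^\dagger]+[\lambda_{j,0}]$ if $\mathcal{L}_i\subsetneq\mathcal{L}_j$; $[\lambda_{i,0}]+[\lambda_j^\dagger]$ if $\mathcal{L}_j\subsetneq\mathcal{L}_i$; $[\lambda_{i,0}]+[\lambda_{j,0}]$ if $\mathcal{L}_i\nsubseteq\mathcal{L}_j$ and $\mathcal{L}_j\nsubseteq\mathcal{L}_i$. mul: - $[\lambda_t]$ if $\mathcal{L}_i=\mathcal{L}_j=\mathcal{N}$; - if $\mathcal{L}_i\subsetneq\mathcal{N}=\mathcal{L}_j$: $[\lambda_t]+[y_j][\lambda_i^\dagger]$ if $\mathcal{L}_k=\mathcal{L}_i$; $[\lambda_t]+[y_j][\lambda_{i,0}]$ if $\mathcal{L}_k\subsetneq\mathcal{L}_i$ and not $C_\star$; $[\Lambda_\star([y_j][\lambda_i^\dagger],[0,0],[\gamma])]$ if $C_\star$; - if $\mathcal{L}_j\subsetneq\mathcal{N}=\mathcal{L}_i$: $[\lambda_t]+[y_i][\lambda_j^\dagger]$ if $\mathcal{L}_k=\mathcal{L}_j$; $[\lambda_t]+[y_i][\lambda_{j,0}]$ if $\mathcal{L}_k\subsetneq\mathcal{L}_j$ and not $C_\star$; $[\Lambda_\star([0,0],[y_i][\lambda_j^\dagger],[\gamma])]$ if $C_\star$; - if $\mathcal{L}_i,\mathcal{L}_j\subsetneq\mathcal{N}$ and $C_\star$: $[\Lambda_\star([y_j][\lambda_i^\dagger],[y_i][\lambda_j^\dagger],[\gamma])]$;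 - if $\mathcal{L}_i,\mathcal{L}_j\subsetneq\mathcal{N}$, $\mathcal{L}_\cup=\mathcal{N}$: $[\lambda_t]+[\Lambda_r([\Lambda_r([y_j][\lambda_i^\dagger],[y_i][\lambda_j^\dagger])],[0,0])]$ if $\mathcal{L}_k\subsetneq\mathcal{L}_\cap$; $[\lambda_t]+[\Lambda_r([y_j][\lambda_i^\dagger],[y_i][\lambda_j^\dagger])]$ if $\mathcal{L}_k=\mathcal{L}_\cap$ and not $C_\star$; - if $\mathcal{L}_\cup\subsetneq\mathcal{N}$: $[\lambda_t]+[y_j][\lambda_i^\dagger]+[y_i][\lambda_j^\dagger]$ if $\mathcal{L}_k=\mathcal{L}_i=\mathcal{L}_j$; $[\lambda_t]+[y_j][\lambda_i^\dagger]+[y_i][\lambda_{j,0}]$ if $\mathcal{L}_k=\mathcal{L}_i\subsetneq\mathcal{L}_j$; $[\lambda_t]+[y_j][\lambda_{i,0}]+[y_i][\lambda_j^\dagger]$ if $\mathcal{L}_k=\mathcal{L}_j\subsetneq\mathcal{L}_i$; $[\lambda_t]+[\Lambda_r([y_j][\lambda_i^\dagger]+[y_i][\lambda_j^\dagger],[0,0])]$ if $\mathcal{L}_k\subsetneq\mathcal{L}_i=\mathcal{L}_j$; $[\lambda_t]+[\Lambda_r([y_j][\lambda_i^\dagger]+[y_i][\lambda_{j,0}],[0,0])]$ if $\mathcal{L}_k\subsetneq\mathcal{L}_i\subsetneq\mathcal{L}_j$; $[\lambda_t]+[\Lambda_r([y_j][\lambda_{i,0}]+[y_i][\lambda_j^\dagger],[0,0])]$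 if $\mathcal{L}_k\subsetneq\mathcal{L}_j\subsetneq\mathcal{L}_i$; $[\lambda_t]+[y_j][\lambda_{i,0}]+[y_i][\lambda_{j,0}]$ if $\mathcal{L}_i\nsubseteq\mathcal{L}_j$ and $\mathcal{L}_j\nsubseteq\mathcal{L}_i$. Unary nonlinear operations: if $\mathcal{L}_i=\mathcal{N}$: powNat $m(m-1)[y_i]^{m-2}[\Lambda_s]$; oneOver $2[y_k]^3[\Lambda_s]$; sqrt $(1/(-4[y_k]^3))[\Lambda_s]$; exp $[y_k][\Lambda_s]$; ln $(-1/[y_i]^2)[\Lambda_s]$. If $\mathcal{L}_i\subsetneq\mathcal{N}$, put $[\mu]=[\lambda_i^\dagger]$ when $\mathcal{L}_k=\mathcal{L}_i$ and $[\mu]=[\lambda_{i,0}]$ when $\mathcal{L}_k\subsetneq\mathcal{L}_i$: powNat $m[y_i]^{m-2}((m-1)[\Lambda_s]+[y_i][\mu])$; oneOver $[y_k]^2(2[y_k][\Lambda_s]-[\mu])$; sqrt $(1/(2[y_k]))\big((1/(-2[y_i]))[\Lambda_s]+[\mu]\big)$; exp $[y_k]([\Lambda_s]+[\mu])$; ln $(1/[y_i])\big([\mu]-(1/[y_i])[\Lambda_s]\big)$. addC, mulByC: $[0,0]$ if $\mathcal{L}_i=\mathcal{N}$; otherwise $[\lambda_i^\dagger]$ (addC), $c[\lambda_i^\dagger]$ (mulByC). *Step 3.* $[\varphi]=[y_{n+t}]$, $[\nabla\varphi]=[\nabla y_{n+t}]$, and $[\lambda_\varphi]=[\lambda_{n+t}^\dagger]$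 if $\mathcal{L}_{n+t}=\emptyset$; $[\lambda_\varphi]=[0,0]$ if $\mathcal{L}_{n+t}=\mathcal{N}$; $[\lambda_\varphi]=[\min\{\underline\lambda_{n+t}^\dagger,0\},\max\{\overline\lambda_{n+t}^\dagger,0\}]$ otherwise. *)

theory Defs
  imports "HOL-Analysis.Analysis" "HOL-Library.Interval"
begin

section \<open>Derivatives and eigenvalues\<close>

definition grad :: "(real ^ 'n \<Rightarrow> real) \<Rightarrow> real ^ 'n \<Rightarrow> real ^ 'n" where
  "grad f x = (\<chi> i. frechet_derivative f (at x) (axis i 1))"

definition hessian :: "(real ^ 'n \<Rightarrow> real) \<Rightarrow> real ^ 'n \<Rightarrow> real ^ 'n ^ 'n" where
  "hessian f x = jacobian (grad f) (at x)"

definition C2_on :: "(real ^ 'n) set \<Rightarrow> (real ^ 'n \<Rightarrow> real) \<Rightarrow> bool" where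
  "C2_on U f \<longleftrightarrow>
     f differentiable_on U \<and> grad f differentiable_on U \<and> continuous_on U (hessian f)"

definition eigenvalues :: "real ^ 'n ^ 'n \<Rightarrow> real set" where
  "eigenvalues A = {c. \<exists>v. v \<noteq> 0 \<and> A *v v = c *s v}"

text \<open>Only meant for symmetric \<open>A\<close>, where the set of eigenvalues is finite and nonempty.\<close>

definition lambda_min :: "real ^ 'n ^ 'n \<Rightarrow> real" where
  "lambda_min A = Min (eigenvalues A)"

definition lambda_max :: "real ^ 'n ^ 'n \<Rightarrow> real" where
  "lambda_max A = Max (eigenvalues A)"


section \<open>Interval arithmetic\<close>

text \<open>
  Addition, subtraction, multiplication, \<open>0 = [0,0]\<close> and \<open>1 = [1,1]\<close> are those of
  \<^theory>\<open>HOL-Library.Interval\<close>; \<open>c[a]\<close> and \<open>[a] + c\<close> are products and sums with the point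
  interval \<open>[c,c]\<close>, and \<open>-[a]\<close> is \<open>(-1)[a]\<close>.  The operator \<open>\<Lambda>\<^sub>r\<close> (interval hull) is \<open>sup\<close>.
  The power of that theory (iterated multiplication) is \<^emph>\<open>not\<close> the one used here: it maps
  \<open>[-1,1]\<close> and \<open>2\<close> to \<open>[-1,1]\<close> instead of \<open>[0,1]\<close>.
\<close>

unbundle interval.lifting

abbreviation iscale :: "real \<Rightarrow> real interval \<Rightarrow> real interval" (infixr \<open>*\<^sub>I\<close> 75) where
  "c *\<^sub>I A \<equiv> interval_of c * A"

lift_definition ipow :: "real interval \<Rightarrow> nat \<Rightarrow> real interval" is
  "\<lambda>(a, b) m.
     if m = 0 then (1, 1)
     else if 0 < a \<or> odd m then (a ^ m, b ^ m)
     else if b < 0 then (b ^ m, a ^ m)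
     else (0, max (a ^ m) (b ^ m))"
  by (auto simp: power_mono_odd le_max_iff_disj zero_le_power_eq split: if_splits
           intro: power_mono) (intro power_mono_even; simp)

text \<open>
  \<open>1/[a]\<close> and \<open>ln [a]\<close> get a dummy value, and \<open>\<surd>[a]\<close> is meaningless, outside their domains; these cases
  are excluded by \<open>algS_well_defined\<close> below.
\<close>

lift_definition iinv :: "real interval \<Rightarrow> real interval" is
  "\<lambda>(a, b). if 0 < a \<or> b < 0 then (1 / b, 1 / a) else (0, 0)"
  by (auto simp: field_simps split: if_splits)

lift_definition isqrt :: "real interval \<Rightarrow> real interval" is
  "\<lambda>(a, b). (sqrt a, sqrt b)"
  by auto

lift_definition iexp :: "real interval \<Rightarrow> real interval" is
  "\<lambda>(a, b). (exp a, exp b)"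
  by auto

lift_definition iln :: "real interval \<Rightarrow> real interval" is
  "\<lambda>(a, b). if 0 < a then (ln a, ln b) else (0, 0)"
  by (auto split: if_splits)

text \<open>The hyperrectangle in \<open>\<real>\<^sup>n\<close> denoted by a vector of intervals.\<close>

definition hyperrect :: "real interval ^ 'n \<Rightarrow> (real ^ 'n) set" where
  "hyperrect A = {x. \<forall>i. x $ i \<in> set_of (A $ i)}"


section \<open>Interval operators\<close>

text \<open>
  For \<open>\<Lambda>\<^sub>s\<close> and \<open>\<Lambda>\<^sub>t\<close> the arguments are given as hyperrectangles in \<open>\<real>\<^sup>n\<close> together with the set \<open>J\<close>
  of retained components, i.e. \<open>Lambda_s J A\<close> stands for \<open>\<Lambda>\<^sub>s\<close> applied to the subvector \<open>A\<^sub>J\<close>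
  of \<open>A\<close>.
\<close>

definition sqsum :: "'n set \<Rightarrow> real interval ^ 'n \<Rightarrow> real" where
  "sqsum J A = (\<Sum>i\<in>J. max ((lower (A $ i))\<^sup>2) ((upper (A $ i))\<^sup>2))"

lemma sqsum_nonneg: "0 \<le> sqsum J A"
  unfolding sqsum_def by (intro sum_nonneg) (simp add: le_max_iff_disj)

definition Lambda_s :: "'n set \<Rightarrow> real interval ^ 'n \<Rightarrow> real interval" where
  "Lambda_s J A =
     (if card J = 1 then ipow (A $ the_elem J) 2 else Interval (0, sqsum J A))"

definition Lambda_t ::
    "'n set \<Rightarrow> real interval ^ 'n \<Rightarrow> real interval ^ 'n \<Rightarrow> real interval" where
  "Lambda_t J A B =
     (if card J = 1 then 2 *\<^sub>I (A $ the_elem J * B $ the_elem J)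
      else let \<beta> = sqrt (sqsum J A * sqsum J B)
           in Interval (- \<beta>, \<beta>) + (\<Sum>i\<in>J. A $ i * B $ i))"

lemma bounds_nonneg_Interval:
  fixes s :: real
  assumes "0 \<le> s"
  shows "lower (Interval (0, s)) = 0" "upper (Interval (0, s)) = s"
    and "lower (Interval (- s, s)) = - s" "upper (Interval (- s, s)) = s"
  using assms by (simp_all add: lower.rep_eq upper.rep_eq Interval_inverse)

lemma Lambda_star_aux:
  fixes a a' b b' d :: real
  assumes "a \<le> a'" "b \<le> b'" "0 \<le> d"
  shows "(a + b - sqrt ((a - b)\<^sup>2 + d)) / 2 \<le> (a' + b' + sqrt ((a' - b')\<^sup>2 + d)) / 2"
proof -
  have "0 \<le> sqrt ((a - b)\<^sup>2 + d)" "0 \<le> sqrt ((a' - b')\<^sup>2 + d)"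
    using assms by auto
  then show ?thesis using assms by (intro divide_right_mono) linarith+
qed

lift_definition Lambda_star ::
    "real interval \<Rightarrow> real interval \<Rightarrow> real interval \<Rightarrow> real interval" is
  "\<lambda>(a, a') (b, b') (c, c').
     let d = 4 * max (c\<^sup>2) (c'\<^sup>2)
     in ((a + b - sqrt ((a - b)\<^sup>2 + d)) / 2, (a' + b' + sqrt ((a' - b')\<^sup>2 + d)) / 2)"
  by (auto simp: Let_def le_max_iff_disj intro!: Lambda_star_aux)

definition hull0 :: "real interval \<Rightarrow> real interval" where
  "hull0 A = sup A 0"


section \<open>Codelists\<close>

text \<open>
  Arguments of type \<^typ>\<open>nat\<close> are indices of earlier values, except for the exponent, which is the
  second argument of \<open>PowNatOp\<close>.
\<close>

datatype operation =
    AddOp nat nat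
  | MulOp nat nat
  | PowNatOp nat nat
  | OneOverOp nat
  | SqrtOp nat
  | ExpOp nat
  | LnOp nat
  | AddCOp nat real
  | MulByCOp real nat

primrec op_args :: "operation \<Rightarrow> nat set" where
  "op_args (AddOp i j) = {i, j}"
| "op_args (MulOp i j) = {i, j}"
| "op_args (PowNatOp i m) = {i}"
| "op_args (OneOverOp i) = {i}"
| "op_args (SqrtOp i) = {i}"
| "op_args (ExpOp i) = {i}"
| "op_args (LnOp i) = {i}"
| "op_args (AddCOp i c) = {i}"
| "op_args (MulByCOp c i) = {i}"

definition op_wf :: "nat \<Rightarrow> operation \<Rightarrow> bool" where
  "op_wf k p \<longleftrightarrow> op_args p \<subseteq> {1..<k} \<and> (\<forall>i m. p = PowNatOp i m \<longrightarrow> 2 \<le> m)"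

primrec op_value :: "(nat \<Rightarrow> real) \<Rightarrow> operation \<Rightarrow> real" where
  "op_value y (AddOp i j) = y i + y j"
| "op_value y (MulOp i j) = y i * y j"
| "op_value y (PowNatOp i m) = y i ^ m"
| "op_value y (OneOverOp i) = 1 / y i"
| "op_value y (SqrtOp i) = sqrt (y i)"
| "op_value y (ExpOp i) = exp (y i)"
| "op_value y (LnOp i) = ln (y i)"
| "op_value y (AddCOp i c) = y i + c"
| "op_value y (MulByCOp c i) = c * y i"

text \<open>
  As \<open>1/\<close>, \<open>sqrt\<close> and \<open>ln\<close> are total functions in HOL, it has to be stated that they are only applied
  where they are mathematically defined.
\<close>

primrec op_dom :: "(nat \<Rightarrow> real) \<Rightarrow> operation \<Rightarrow> bool" where
  "op_dom y (AddOp i j) \<longleftrightarrow> True"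
| "op_dom y (MulOp i j) \<longleftrightarrow> True"
| "op_dom y (PowNatOp i m) \<longleftrightarrow> True"
| "op_dom y (OneOverOp i) \<longleftrightarrow> y i \<noteq> 0"
| "op_dom y (SqrtOp i) \<longleftrightarrow> 0 \<le> y i"
| "op_dom y (ExpOp i) \<longleftrightarrow> True"
| "op_dom y (LnOp i) \<longleftrightarrow> 0 < y i"
| "op_dom y (AddCOp i c) \<longleftrightarrow> True"
| "op_dom y (MulByCOp c i) \<longleftrightarrow> True"

text \<open>
  The coordinates of \<open>\<real>\<^sup>n\<close> are indexed by a finite type \<open>'n\<close>; \<open>idx\<close> numbers them, so that \<open>x\<^sub>k\<close> is
  \<open>x $ idx k\<close> for \<open>k = 1, \<dots>, n\<close>.  The operation defining \<open>y\<^sub>k\<close> is \<open>ops k\<close> for \<open>k = n+1, \<dots>, n+t\<close>; other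
  values of \<open>ops\<close> are irrelevant.
\<close>

definition is_codelist ::
    "(nat \<Rightarrow> 'n) \<Rightarrow> (nat \<Rightarrow> operation) \<Rightarrow> nat \<Rightarrow> (real ^ 'n) set \<Rightarrow> (real ^ 'n \<Rightarrow> real) \<Rightarrow> bool" where
  "is_codelist idx ops t U \<phi> \<longleftrightarrow>
     (\<forall>k\<in>{CARD('n) + 1..CARD('n) + t}. op_wf k (ops k)) \<and>
     (\<exists>y :: nat \<Rightarrow> real ^ 'n \<Rightarrow> real. \<forall>x\<in>U.
        (\<forall>k\<in>{1..CARD('n)}. y k x = x $ idx k) \<and>
        (\<forall>k\<in>{CARD('n) + 1..CARD('n) + t}.
           op_dom (\<lambda>i. y i x) (ops k) \<and> y k x = op_value (\<lambda>i. y i x) (ops k)) \<and>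
        \<phi> x = y (CARD('n) + t) x)"


section \<open>The sparse algorithm\<close>

text \<open>
  The data computed for \<open>y\<^sub>k\<close>: the index sets \<open>\<I>\<^sub>k\<close> and \<open>\<L>\<^sub>k\<close> and the intervals \<open>[y\<^sub>k]\<close>, \<open>[\<nabla>y\<^sub>k]\<close>
  and \<open>[\<lambda>\<^sub>k\<^sup>\<dagger>]\<close>.  The set \<open>{1,\<dots>,n}\<close> is \<open>UNIV :: 'n set\<close>, and \<open>- J\<close> is the complement of \<open>J\<close> in it.
\<close>

record ('n::finite) node =
  nI :: "'n set"
  nL :: "'n set"
  nY :: "real interval"
  nG :: "real interval ^ 'n"
  nLam :: "real interval"

definition init_node :: "(nat \<Rightarrow> 'n::finite) \<Rightarrow> real interval ^ 'n \<Rightarrow> nat \<Rightarrow> 'n node" where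
  "init_node idx X k =
     \<lparr> nI = UNIV - {idx k}, nL = UNIV, nY = X $ idx k, nG = axis (idx k) 1, nLam = 0 \<rparr>"

text \<open>In what follows \<open>S i\<close> is the data of the earlier \<open>y\<^sub>i\<close>.\<close>

primrec step_I :: "(nat \<Rightarrow> 'n::finite node) \<Rightarrow> operation \<Rightarrow> 'n set" where
  "step_I S (AddOp i j) = nI (S i) \<inter> nI (S j)"
| "step_I S (MulOp i j) = nI (S i) \<inter> nI (S j)"
| "step_I S (PowNatOp i m) = nI (S i)"
| "step_I S (OneOverOp i) = nI (S i)"
| "step_I S (SqrtOp i) = nI (S i)"
| "step_I S (ExpOp i) = nI (S i)"
| "step_I S (LnOp i) = nI (S i)"
| "step_I S (AddCOp i c) = nI (S i)"
| "step_I S (MulByCOp c i) = nI (S i)"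

primrec step_L :: "(nat \<Rightarrow> 'n::finite node) \<Rightarrow> operation \<Rightarrow> 'n set" where
  "step_L S (AddOp i j) = nL (S i) \<inter> nL (S j)"
| "step_L S (MulOp i j) = nI (S i) \<inter> nI (S j)"
| "step_L S (PowNatOp i m) = nI (S i)"
| "step_L S (OneOverOp i) = nI (S i)"
| "step_L S (SqrtOp i) = nI (S i)"
| "step_L S (ExpOp i) = nI (S i)"
| "step_L S (LnOp i) = nI (S i)"
| "step_L S (AddCOp i c) = nL (S i)"
| "step_L S (MulByCOp c i) = nL (S i)"

primrec step_Y :: "(nat \<Rightarrow> 'n::finite node) \<Rightarrow> operation \<Rightarrow> real interval" where
  "step_Y S (AddOp i j) = nY (S i) + nY (S j)"
| "step_Y S (MulOp i j) = nY (S i) * nY (S j)"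
| "step_Y S (PowNatOp i m) = ipow (nY (S i)) m"
| "step_Y S (OneOverOp i) = iinv (nY (S i))"
| "step_Y S (SqrtOp i) = isqrt (nY (S i))"
| "step_Y S (ExpOp i) = iexp (nY (S i))"
| "step_Y S (LnOp i) = iln (nY (S i))"
| "step_Y S (AddCOp i c) = nY (S i) + interval_of c"
| "step_Y S (MulByCOp c i) = c *\<^sub>I nY (S i)"

text \<open>The argument \<open>Yk\<close> is the interval \<open>[y\<^sub>k]\<close> computed by \<open>step_Y\<close> in the same step.\<close>

primrec step_G ::
    "(nat \<Rightarrow> 'n::finite node) \<Rightarrow> real interval \<Rightarrow> operation \<Rightarrow> real interval ^ 'n" where
  "step_G S Yk (AddOp i j) = nG (S i) + nG (S j)"
| "step_G S Yk (MulOp i j) = nY (S j) *s nG (S i) + nY (S i) *s nG (S j)"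
| "step_G S Yk (PowNatOp i m) = (real m *\<^sub>I ipow (nY (S i)) (m - 1)) *s nG (S i)"
| "step_G S Yk (OneOverOp i) = (- ipow Yk 2) *s nG (S i)"
| "step_G S Yk (SqrtOp i) = iinv (2 *\<^sub>I Yk) *s nG (S i)"
| "step_G S Yk (ExpOp i) = Yk *s nG (S i)"
| "step_G S Yk (LnOp i) = iinv (nY (S i)) *s nG (S i)"
| "step_G S Yk (AddCOp i c) = nG (S i)"
| "step_G S Yk (MulByCOp c i) = interval_of c *s nG (S i)"

definition lam_add :: "'n::finite node \<Rightarrow> 'n node \<Rightarrow> real interval" where
  "lam_add P Q =
     (let Li = nL P; Lj = nL Q; li = nLam P; lj = nLam Q in
      if Li = UNIV \<and> Lj = UNIV then 0
      else if Li \<subset> UNIV \<and> Lj = UNIV then li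
      else if Lj \<subset> UNIV \<and> Li = UNIV then lj
      else if Li \<union> Lj = UNIV then sup li lj
      else if Li = Lj then li + lj
      else if Li \<subset> Lj then li + hull0 lj
      else if Lj \<subset> Li then hull0 li + lj
      else hull0 li + hull0 lj)"

text \<open>
  \<open>C\<close> is the condition \<open>C\<^sub>\<star>\<close>; under it the complements of \<open>\<I>\<^sub>i\<close> and \<open>\<I>\<^sub>j\<close> are singletons, and \<open>\<gamma>\<close>
  is the product of the corresponding components of the gradient hyperrectangles.  As all index
  sets computed satisfy \<open>\<I> \<subseteq> \<L>\<close>, the case \<open>C\<close> excludes \<open>\<L>\<^sub>k = \<L>\<^sub>i\<close> and \<open>\<L>\<^sub>k = \<L>\<^sub>j\<close>.
\<close>

definition lam_mul :: "'n::finite node \<Rightarrow> 'n node \<Rightarrow> 'n set \<Rightarrow> real interval" where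
  "lam_mul P Q Lk =
     (let Ii = nI P; Ij = nI Q; Li = nL P; Lj = nL Q;
          A = nY Q * nLam P; A0 = nY Q * hull0 (nLam P);
          B = nY P * nLam Q; B0 = nY P * hull0 (nLam Q);
          lt = Lambda_t (- Lk) (nG P) (nG Q);
          \<gamma> = nG P $ the_elem (- Ii) * nG Q $ the_elem (- Ij);
          C = (Ii \<union> Ij = UNIV \<and> card Ii = CARD('n) - 1 \<and> card Ij = CARD('n) - 1)
      in
      if Li = UNIV \<and> Lj = UNIV then lt
      else if Li \<subset> UNIV \<and> Lj = UNIV then
        (if Lk = Li then lt + A
         else if \<not> C then lt + A0
         else Lambda_star A 0 \<gamma>)
      else if Lj \<subset> UNIV \<and> Li = UNIV then
        (if Lk = Lj then lt + B
         else if \<not> C then lt + B0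
         else Lambda_star 0 B \<gamma>)
      else if C then Lambda_star A B \<gamma>
      else if Li \<union> Lj = UNIV then
        (if Lk \<subset> Li \<inter> Lj then lt + sup (sup A B) 0
         else lt + sup A B)
      else if Lk = Li \<and> Li = Lj then lt + A + B
      else if Lk = Li \<and> Li \<subset> Lj then lt + A + B0
      else if Lk = Lj \<and> Lj \<subset> Li then lt + A0 + B
      else if Lk \<subset> Li \<and> Li = Lj then lt + sup (A + B) 0
      else if Lk \<subset> Li \<and> Li \<subset> Lj then lt + sup (A + B0) 0
      else if Lk \<subset> Lj \<and> Lj \<subset> Li then lt + sup (A0 + B) 0
      else lt + A0 + B0)"

text \<open>The interval \<open>[\<mu>]\<close> used for the unary nonlinear operations when \<open>\<L>\<^sub>i \<noteq> \<N>\<close>.\<close>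

definition lam_mu :: "'n::finite node \<Rightarrow> 'n set \<Rightarrow> real interval" where
  "lam_mu P Lk = (if Lk = nL P then nLam P else hull0 (nLam P))"

primrec step_Lam ::
    "(nat \<Rightarrow> 'n::finite node) \<Rightarrow> 'n set \<Rightarrow> real interval \<Rightarrow> operation \<Rightarrow> real interval" where
  "step_Lam S Lk Yk (AddOp i j) = lam_add (S i) (S j)"
| "step_Lam S Lk Yk (MulOp i j) = lam_mul (S i) (S j) Lk"
| "step_Lam S Lk Yk (PowNatOp i m) =
     (let Yi = nY (S i); \<Lambda>s = Lambda_s (- Lk) (nG (S i)); \<mu> = lam_mu (S i) Lk in
      if nL (S i) = UNIV then real (m * (m - 1)) *\<^sub>I ipow Yi (m - 2) * \<Lambda>s
      else real m *\<^sub>I ipow Yi (m - 2) * (real (m - 1) *\<^sub>I \<Lambda>s + Yi * \<mu>))"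
| "step_Lam S Lk Yk (OneOverOp i) =
     (let \<Lambda>s = Lambda_s (- Lk) (nG (S i)); \<mu> = lam_mu (S i) Lk in
      if nL (S i) = UNIV then 2 *\<^sub>I ipow Yk 3 * \<Lambda>s
      else ipow Yk 2 * (2 *\<^sub>I Yk * \<Lambda>s - \<mu>))"
| "step_Lam S Lk Yk (SqrtOp i) =
     (let Yi = nY (S i); \<Lambda>s = Lambda_s (- Lk) (nG (S i)); \<mu> = lam_mu (S i) Lk in
      if nL (S i) = UNIV then iinv ((- 4) *\<^sub>I ipow Yk 3) * \<Lambda>s
      else iinv (2 *\<^sub>I Yk) * (iinv ((- 2) *\<^sub>I Yi) * \<Lambda>s + \<mu>))"
| "step_Lam S Lk Yk (ExpOp i) =
     (let \<Lambda>s = Lambda_s (- Lk) (nG (S i)); \<mu> = lam_mu (S i) Lk in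
      if nL (S i) = UNIV then Yk * \<Lambda>s
      else Yk * (\<Lambda>s + \<mu>))"
| "step_Lam S Lk Yk (LnOp i) =
     (let Yi = nY (S i); \<Lambda>s = Lambda_s (- Lk) (nG (S i)); \<mu> = lam_mu (S i) Lk in
      if nL (S i) = UNIV then (- iinv (ipow Yi 2)) * \<Lambda>s
      else iinv Yi * (\<mu> - iinv Yi * \<Lambda>s))"
| "step_Lam S Lk Yk (AddCOp i c) = (if nL (S i) = UNIV then 0 else nLam (S i))"
| "step_Lam S Lk Yk (MulByCOp c i) = (if nL (S i) = UNIV then 0 else c *\<^sub>I nLam (S i))"

definition step_node :: "(nat \<Rightarrow> 'n::finite node) \<Rightarrow> operation \<Rightarrow> 'n node" where
  "step_node S p =
     (let Lk = step_L S p; Yk = step_Y S p in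
      \<lparr> nI = step_I S p, nL = Lk, nY = Yk, nG = step_G S Yk p, nLam = step_Lam S Lk Yk p \<rparr>)"

text \<open>\<open>algS_nodes idx ops X s\<close> holds the data of \<open>y\<^sub>1, \<dots>, y\<^bsub>n+s\<^esub>\<close> at the indices \<open>1, \<dots>, n+s\<close>.\<close>

primrec algS_nodes ::
    "(nat \<Rightarrow> 'n::finite) \<Rightarrow> (nat \<Rightarrow> operation) \<Rightarrow> real interval ^ 'n \<Rightarrow> nat \<Rightarrow> nat \<Rightarrow> 'n node" where
  "algS_nodes idx ops X 0 = init_node idx X"
| "algS_nodes idx ops X (Suc s) =
     (let S = algS_nodes idx ops X s; k = CARD('n) + Suc s
      in S(k := step_node S (ops k)))"

definition algS ::
    "(nat \<Rightarrow> 'n::finite) \<Rightarrow> (nat \<Rightarrow> operation) \<Rightarrow> nat \<Rightarrow> real interval ^ 'n \<Rightarrow>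
       real interval \<times> (real interval ^ 'n) \<times> real interval" where
  "algS idx ops t X =
     (let P = algS_nodes idx ops X t (CARD('n) + t)
      in (nY P, nG P,
          if nL P = {} then nLam P
          else if nL P = UNIV then 0
          else hull0 (nLam P)))"

text \<open>
  All interval operations performed are well defined.  Quotients and roots occur only in the
  following cases.  For \<open>sqrt\<close> the conditions are those of \<open>\<surd>[y\<^sub>i]\<close> and \<open>1/(2[y\<^sub>k])\<close>, which imply
  those of \<open>1/(-4[y\<^sub>k]\<^sup>3)\<close> and \<open>1/(-2[y\<^sub>i])\<close>; for \<open>ln\<close> the condition of \<open>ln [y\<^sub>i]\<close> implies those of
  \<open>1/[y\<^sub>i]\<close> and \<open>1/[y\<^sub>i]\<^sup>2\<close>.
\<close>

primrec op_well_defined :: "(nat \<Rightarrow> 'n::finite node) \<Rightarrow> nat \<Rightarrow> operation \<Rightarrow> bool" where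
  "op_well_defined S k (AddOp i j) \<longleftrightarrow> True"
| "op_well_defined S k (MulOp i j) \<longleftrightarrow> True"
| "op_well_defined S k (PowNatOp i m) \<longleftrightarrow> True"
| "op_well_defined S k (OneOverOp i) \<longleftrightarrow> 0 \<notin> set_of (nY (S i))"
| "op_well_defined S k (SqrtOp i) \<longleftrightarrow> 0 \<le> lower (nY (S i)) \<and> 0 \<notin> set_of (nY (S k))"
| "op_well_defined S k (ExpOp i) \<longleftrightarrow> True"
| "op_well_defined S k (LnOp i) \<longleftrightarrow> 0 < lower (nY (S i))"
| "op_well_defined S k (AddCOp i c) \<longleftrightarrow> True"
| "op_well_defined S k (MulByCOp c i) \<longleftrightarrow> True"

definition algS_well_defined ::
    "(nat \<Rightarrow> 'n::finite) \<Rightarrow> (nat \<Rightarrow> operation) \<Rightarrow> nat \<Rightarrow> real interval ^ 'n \<Rightarrow> bool" where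
  "algS_well_defined idx ops t X \<longleftrightarrow>
     (\<forall>k\<in>{CARD('n) + 1..CARD('n) + t}. op_well_defined (algS_nodes idx ops X t) k (ops k))"

end

theory Submission
  imports Defs
begin

text \<open>
  Fix a point \<open>x\<close> of the box.  Going along the codelist, one follows the value, the gradient and
  the Hessian \<open>H\<^sub>k\<close> of every \<open>y\<^sub>k\<close> at \<open>x\<close>.  For the value and the gradient this is the usual
  enclosure property of interval arithmetic.  For the Hessian the invariant is
  \<open>v\<^sup>T H\<^sub>k v \<in> [\<lambda>\<^sub>k\<^sup>\<dagger>] \<Sum>\<^bsub>i \<notin> \<L>\<^sub>k\<^esub> v\<^sub>i\<^sup>2\<close> for all \<open>v\<close>,
  i.e. the form of \<open>H\<^sub>k\<close> is concentrated on the coordinates outside \<open>\<L>\<^sub>k\<close> and its eigenvalues on that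
  coordinate subspace lie in \<open>[\<lambda>\<^sub>k\<^sup>\<dagger>]\<close>.  If \<open>\<L>\<^sub>k = \<N>\<close> the sum is empty and the invariant says that
  the form vanishes, whatever the interval is.

  Working with forms makes each case of the algorithm a statement about numbers.  By the chain and
  product rules, \<open>v\<^sup>T H\<^sub>k v\<close> is a combination of \<open>v\<^sup>T H\<^sub>i v\<close> and \<open>v\<^sup>T H\<^sub>j v\<close> and of products of the
  \<open>\<nabla>y\<^sub>i \<bullet> v\<close> and \<open>\<nabla>y\<^sub>j \<bullet> v\<close>.  The latter are bounded by \<open>\<Lambda>\<^sub>s\<close> and \<open>\<Lambda>\<^sub>t\<close>, which are the eigenvalue bounds for
  \<open>g g\<^sup>T\<close> (\<open>square_inner_in_Lambda_s\<close>) and \<open>g h\<^sup>T + h g\<^sup>T\<close> (\<open>inner_product_in_Lambda_t\<close>).  The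
  former have to be seen as forms on the possibly larger subspace belonging to \<open>\<L>\<^sub>k\<close>: a form on a proper
  subspace acquires the eigenvalue \<open>0\<close> (\<open>in_multiple_hull0\<close>), and two forms on complementary
  subspaces make up a block diagonal one, whose eigenvalues lie in the hull (\<open>in_multiple_sup\<close>).  In the
  special case \<open>C\<^sub>\<star>\<close> the form lives on two coordinates and \<open>\<Lambda>\<^sub>\<star>\<close> bounds the eigenvalues
  of a \<open>2 \<times> 2\<close> matrix (\<open>two_by_two_form_in_Lambda_star\<close>).

  At the end of the codelist, the final adjustment of \<open>[\<lambda>\<^sub>\<phi>]\<close> turns the invariant into
  \<open>v\<^sup>T H v \<in> [\<lambda>\<^sub>\<phi>] \<parallel>v\<parallel>\<^sup>2\<close>.  Inserting eigenvectors of the symmetric matrix \<open>H\<close> shows that all its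
  eigenvalues are in \<open>[\<lambda>\<^sub>\<phi>]\<close>.
\<close>

section \<open>Enclosure properties of interval arithmetic\<close>

lemma set_of_interval_of_iff [simp]: "x \<in> set_of (interval_of c) \<longleftrightarrow> x = (c::real)"
  by (auto simp: set_of_eq)

lemma set_of_zero_interval [simp]: "set_of (0 :: real interval) = {0}"
  by (auto simp: set_of_eq)

lemma sum_in_interval:
  fixes f :: "'i \<Rightarrow> real"
  assumes "\<And>i. i \<in> I \<Longrightarrow> f i \<in> set_of (A i)"
  shows "(\<Sum>i\<in>I. f i) \<in> set_of (\<Sum>i\<in>I. A i)"
  using assms by (induction I rule: infinite_finite_induct) (auto intro: plus_in_intervalI)

lemma scale_in_interval: "x \<in> set_of A \<Longrightarrow> c * x \<in> set_of (c *\<^sub>I A)"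
  by (intro times_in_intervalI) simp_all

lemma bounds_ipow:
  "lower (ipow A m) =
     (if m = 0 then 1 else if 0 < lower A \<or> odd m then lower A ^ m
      else if upper A < 0 then upper A ^ m else 0)"
  "upper (ipow A m) =
     (if m = 0 then 1 else if 0 < lower A \<or> odd m then upper A ^ m
      else if upper A < 0 then lower A ^ m else max (lower A ^ m) (upper A ^ m))"
  by (transfer, auto)+

lemma power_in_ipow:
  assumes "x \<in> set_of A"
  shows "x ^ m \<in> set_of (ipow A m)"
proof -
  have le: "lower A \<le> x" "x \<le> upper A"
    using assms by (auto simp: set_of_eq)
  consider "m = 0" | "0 < m" "0 < lower A \<or> odd m"
    | "0 < m" "even m" "\<not> 0 < lower A" "upper A < 0"
    | "0 < m" "even m" "\<not> 0 < lower A" "\<not> upper A < 0"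
    by blast
  then show ?thesis
  proof cases
    case 2
    then show ?thesis using le
      by (auto simp: set_of_eq bounds_ipow intro: power_mono power_mono_odd)
  next
    case 3
    then show ?thesis using le
      by (auto simp: set_of_eq bounds_ipow intro!: power_mono_even)
  next
    case 4
    have "x ^ m \<le> max (lower A ^ m) (upper A ^ m)"
    proof (cases "0 \<le> x")
      case True
      then show ?thesis using le by (simp add: le_max_iff_disj power_mono)
    next
      case False
      with le \<open>even m\<close> have "x ^ m \<le> lower A ^ m" by (intro power_mono_even) auto
      then show ?thesis by simp
    qed
    with 4 show ?thesis by (auto simp: set_of_eq bounds_ipow zero_le_even_power)
  qed (simp add: set_of_eq bounds_ipow)
qed

lemma inverse_in_iinv:
  assumes "x \<in> set_of A" "0 \<notin> set_of A"
  shows "1 / x \<in> set_of (iinv A)"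
  using assms by transfer (auto simp: field_simps)

lemma sqrt_in_isqrt: "x \<in> set_of A \<Longrightarrow> sqrt x \<in> set_of (isqrt A)"
  by transfer auto

lemma exp_in_iexp: "x \<in> set_of A \<Longrightarrow> exp x \<in> set_of (iexp A)"
  by transfer auto

lemma ln_in_iln: "x \<in> set_of A \<Longrightarrow> 0 < lower A \<Longrightarrow> ln x \<in> set_of (iln A)"
  by transfer auto

lemma zero_notin_scaled: "c \<noteq> 0 \<Longrightarrow> 0 \<notin> set_of A \<Longrightarrow> 0 \<notin> set_of (c *\<^sub>I A)"
  by (auto simp: set_of_times)

lemma zero_notin_pos: "0 < lower A \<Longrightarrow> 0 \<notin> set_of A" for A :: "real interval"
  by (auto simp: set_of_eq)

lemma lower_ipow_pos: "0 < lower A \<Longrightarrow> 0 < lower (ipow A m)"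
  by (simp add: bounds_ipow)

lemma lower_isqrt_pos: "0 \<le> lower A \<Longrightarrow> 0 \<notin> set_of (isqrt A) \<Longrightarrow> 0 < lower A \<and> 0 < lower (isqrt A)"
  by transfer (auto simp: less_le)

section \<open>Interval multiples and partial norms\<close>

text \<open>
  The invariant of the algorithm bounds a quadratic form by an interval multiple of a squared
  partial norm \<open>s\<close>.  For \<open>s = 0\<close> this forces \<open>q = 0\<close> whatever the interval is, so that a
  vanishing Hessian (\<open>\<L>\<^sub>k = \<N>\<close>), for which the recorded interval is meaningless, needs no
  separate invariant.
\<close>

definition in_multiple :: "real \<Rightarrow> real interval \<Rightarrow> real \<Rightarrow> bool" where
  "in_multiple q A s \<longleftrightarrow> (\<exists>l\<in>set_of A. q = l * s)"

lemma in_multiple_iff: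
  assumes "0 \<le> s"
  shows "in_multiple q A s \<longleftrightarrow> lower A * s \<le> q \<and> q \<le> upper A * s"
proof
  assume "in_multiple q A s"
  then show "lower A * s \<le> q \<and> q \<le> upper A * s"
    using assms by (auto simp: in_multiple_def set_of_eq intro: mult_right_mono)
next
  assume q: "lower A * s \<le> q \<and> q \<le> upper A * s"
  show "in_multiple q A s"
  proof (cases "s = 0")
    case True
    then show ?thesis using q by (auto simp: in_multiple_def set_of_eq intro!: bexI[of _ "lower A"])
  next
    case False
    then show ?thesis using q assms
      by (auto simp: in_multiple_def set_of_eq field_simps intro!: bexI[of _ "q / s"])
  qed
qed

lemma in_multiple_zero: "in_multiple q A 0 \<Longrightarrow> q = 0"
  by (auto simp: in_multiple_def)

lemma in_multiple_plus:
  "in_multiple q A s \<Longrightarrow> in_multiple r B s \<Longrightarrow> in_multiple (q + r) (A + B) s"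
  unfolding in_multiple_def by (metis distrib_right plus_in_intervalI)

lemma in_multiple_times:
  "c \<in> set_of C \<Longrightarrow> in_multiple q A s \<Longrightarrow> in_multiple (c * q) (C * A) s"
  unfolding in_multiple_def by (metis mult.assoc times_in_intervalI)

text \<open>
  The reason for adjoining \<open>0\<close> to an eigenvalue interval: seen as a form on a larger coordinate
  subspace, the form acquires the eigenvalue \<open>0\<close>.
\<close>

lemma in_multiple_hull0:
  assumes "in_multiple q A s" "0 \<le> s" "s \<le> s'"
  shows "in_multiple q (hull0 A) s'"
proof -
  have "inf (lower A) 0 * s' \<le> inf (lower A) 0 * s"
    using assms by (intro mult_left_mono_neg) auto
  also have "\<dots> \<le> lower A * s"
    using assms by (intro mult_right_mono) auto
  finally have 1: "inf (lower A) 0 * s' \<le> lower A * s" .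
  have "upper A * s \<le> sup (upper A) 0 * s"
    using assms by (intro mult_right_mono) auto
  also have "\<dots> \<le> sup (upper A) 0 * s'"
    using assms by (intro mult_left_mono) auto
  finally show ?thesis
    using 1 assms by (auto simp: in_multiple_iff hull0_def)
qed

text \<open>
  The eigenvalues of a block diagonal matrix are those of the blocks; here \<open>s\<close> and \<open>s'\<close> are
  the squared norms of the two components of a vector.
\<close>

lemma in_multiple_sup:
  assumes "in_multiple q A s" "in_multiple r B s'" "0 \<le> s" "0 \<le> s'"
  shows "in_multiple (q + r) (sup A B) (s + s')"
proof -
  have "inf (lower A) (lower B) * s \<le> lower A * s" "inf (lower A) (lower B) * s' \<le> lower B * s'"
    "upper A * s \<le> sup (upper A) (upper B) * s" "upper B * s' \<le> sup (upper A) (upper B) * s'"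
    using assms by (auto intro!: mult_right_mono)
  then show ?thesis
    using assms by (auto simp: in_multiple_iff distrib_left intro: add_mono)
qed

definition sqnorm_on :: "'n set \<Rightarrow> real ^ 'n \<Rightarrow> real" where
  "sqnorm_on J v = (\<Sum>i\<in>J. (v $ i)\<^sup>2)"

lemma sqnorm_on_nonneg: "0 \<le> sqnorm_on J v"
  by (simp add: sqnorm_on_def sum_nonneg)

lemma sqnorm_on_mono: "J \<subseteq> K \<Longrightarrow> sqnorm_on J v \<le> sqnorm_on K v" for J :: "'n::finite set"
  by (simp add: sqnorm_on_def sum_mono2)

lemma sqnorm_on_empty [simp]: "sqnorm_on {} v = 0"
  by (simp add: sqnorm_on_def)

lemma sqnorm_on_UNIV: "sqnorm_on UNIV v = v \<bullet> v"
  by (simp add: sqnorm_on_def inner_vec_def power2_eq_square)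

lemma sqnorm_on_Un:
  "J \<inter> K = {} \<Longrightarrow> sqnorm_on (J \<union> K) v = sqnorm_on J v + sqnorm_on K v" for J :: "'n::finite set"
  by (simp add: sqnorm_on_def sum.union_disjoint)

section \<open>Quadratic forms of low rank\<close>

lemma inner_supported:
  fixes g v :: "real ^ 'n"
  assumes "\<And>i. i \<notin> J \<Longrightarrow> g $ i = 0"
  shows "g \<bullet> v = (\<Sum>i\<in>J. g $ i * v $ i)"
  unfolding inner_vec_def inner_real_def
  using assms by (intro sum.mono_neutral_right) auto

lemma sqnorm_le_sqsum:
  fixes g :: "real ^ 'n"
  assumes "g \<in> hyperrect A"
  shows "sqnorm_on J g \<le> sqsum J A"
  unfolding sqnorm_on_def sqsum_def
proof (intro sum_mono)
  fix i assume "i \<in> J"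
  have l: "lower (A $ i) \<le> g $ i" "g $ i \<le> upper (A $ i)"
    using assms by (auto simp: hyperrect_def set_of_eq)
  show "(g $ i)\<^sup>2 \<le> max ((lower (A $ i))\<^sup>2) ((upper (A $ i))\<^sup>2)"
    using l by (cases "0 \<le> g $ i") (auto simp: le_max_iff_disj abs_le_square_iff[symmetric])
qed

text \<open>
  Forms built from vectors supported on \<open>J\<close> only see the restriction of \<open>v\<close> to \<open>J\<close>; this passes
  from \<open>\<parallel>v\<parallel>\<close> to the partial norm in inequalities stated for whole vectors.
\<close>

lemma restrict_vector:
  fixes v :: "real ^ 'n"
  obtains w where "w \<bullet> w = sqnorm_on J v"
    and "\<And>g. (\<And>i. i \<notin> J \<Longrightarrow> g $ i = 0) \<Longrightarrow> g \<bullet> w = g \<bullet> v"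
proof
  let ?w = "(\<chi> i. if i \<in> J then v $ i else 0) :: real ^ 'n"
  have "?w \<bullet> ?w = (\<Sum>i\<in>J. ?w $ i * ?w $ i)"
    by (rule inner_supported) auto
  then show "?w \<bullet> ?w = sqnorm_on J v"
    by (simp add: sqnorm_on_def power2_eq_square)
  show "g \<bullet> ?w = g \<bullet> v" if "\<And>i. i \<notin> J \<Longrightarrow> g $ i = 0" for g
    using inner_supported[of J g ?w] inner_supported[of J g v] that by simp
qed

text \<open>
  The eigenvalues of \<open>a b\<^sup>T + b a\<^sup>T\<close> lie between \<open>a \<bullet> b - \<parallel>a\<parallel> \<parallel>b\<parallel>\<close> and \<open>a \<bullet> b + \<parallel>a\<parallel> \<parallel>b\<parallel>\<close>.  The vector
  \<open>r = 2 (a \<bullet> w) w - \<parallel>w\<parallel>\<^sup>2 a\<close> is \<open>\<parallel>w\<parallel>\<^sup>2\<close> times the reflection of \<open>a\<close> in the line through \<open>w\<close>, hence has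
  norm \<open>\<parallel>w\<parallel>\<^sup>2 \<parallel>a\<parallel>\<close>, and the left-hand side is \<open>\<bar>r \<bullet> b\<bar>\<close>; Cauchy-Schwarz does the rest.
\<close>

lemma two_inner_products_bound:
  fixes a b w :: "'a::real_inner"
  shows "\<bar>2 * (a \<bullet> w) * (b \<bullet> w) - (a \<bullet> b) * (w \<bullet> w)\<bar> \<le> norm a * norm b * (w \<bullet> w)"
proof -
  let ?r = "(2 * (a \<bullet> w)) *\<^sub>R w - (w \<bullet> w) *\<^sub>R a"
  have "?r \<bullet> ?r = (w \<bullet> w)\<^sup>2 * (a \<bullet> a)"
    by (simp add: inner_diff_left inner_diff_right inner_commute algebra_simps power2_eq_square)
  then have "(norm ?r)\<^sup>2 = ((w \<bullet> w) * norm a)\<^sup>2"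
    by (simp add: power2_norm_eq_inner power_mult_distrib)
  then have r: "norm ?r = (w \<bullet> w) * norm a"
    by (simp add: power2_eq_iff_nonneg)
  have "\<bar>?r \<bullet> b\<bar> \<le> norm ?r * norm b"
    by (rule Cauchy_Schwarz_ineq2)
  then show ?thesis
    unfolding r by (simp add: inner_diff_left inner_commute algebra_simps)
qed

text \<open>
  This is the form of the rank one matrix \<open>g g\<^sup>T\<close>.  If only one coordinate is retained, it is
  \<open>g\<^sub>j\<^sup>2 v\<^sub>j\<^sup>2\<close> and nothing is lost; otherwise it is nonnegative and Cauchy-Schwarz gives the upper bound.
\<close>

lemma square_inner_in_Lambda_s:
  fixes g v :: "real ^ 'n"
  assumes g: "g \<in> hyperrect A" and supp: "\<And>i. i \<notin> J \<Longrightarrow> g $ i = 0"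
  shows "in_multiple ((g \<bullet> v)\<^sup>2) (Lambda_s J A) (sqnorm_on J v)"
proof (cases "card J = 1")
  case True
  then obtain j where J: "J = {j}" by (auto simp: card_1_singleton_iff)
  have "g \<bullet> v = g $ j * v $ j"
    using inner_supported[of J g v] supp J by simp
  moreover have "(g $ j)\<^sup>2 \<in> set_of (ipow (A $ j) 2)"
    using g by (intro power_in_ipow) (simp add: hyperrect_def)
  ultimately show ?thesis
    by (auto simp: J Lambda_s_def in_multiple_def sqnorm_on_def power_mult_distrib)
next
  case False
  obtain w where w: "w \<bullet> w = sqnorm_on J v"
    and gw: "\<And>g. (\<And>i. i \<notin> J \<Longrightarrow> g $ i = 0) \<Longrightarrow> g \<bullet> w = g \<bullet> v"
    using restrict_vector[of J v] by blast
  have "(g \<bullet> w)\<^sup>2 \<le> (g \<bullet> g) * (w \<bullet> w)"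
    by (rule Cauchy_Schwarz_ineq)
  also have "g \<bullet> g = sqnorm_on J g"
    using inner_supported[of J g g] supp by (simp add: sqnorm_on_def power2_eq_square)
  also have "sqnorm_on J g * (w \<bullet> w) \<le> sqsum J A * (w \<bullet> w)"
    using g by (intro mult_right_mono sqnorm_le_sqsum) auto
  finally have "(g \<bullet> v)\<^sup>2 \<le> sqsum J A * sqnorm_on J v"
    using gw[of g] supp w by simp
  then show ?thesis
    using False by (simp add: Lambda_s_def in_multiple_iff sqnorm_on_nonneg
        bounds_nonneg_Interval sqsum_nonneg)
qed

text \<open>
  This is the form of \<open>g h\<^sup>T + h g\<^sup>T\<close>, the part of the Hessian of a product that comes from the
  gradients of the factors.
\<close>

lemma inner_product_in_Lambda_t:
  fixes g h v :: "real ^ 'n"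
  assumes g: "g \<in> hyperrect A" and h: "h \<in> hyperrect B"
    and supp: "\<And>i. i \<notin> J \<Longrightarrow> g $ i = 0" "\<And>i. i \<notin> J \<Longrightarrow> h $ i = 0"
  shows "in_multiple (2 * (g \<bullet> v) * (h \<bullet> v)) (Lambda_t J A B) (sqnorm_on J v)"
proof (cases "card J = 1")
  case True
  then obtain j where J: "J = {j}" by (auto simp: card_1_singleton_iff)
  have "g \<bullet> v = g $ j * v $ j" "h \<bullet> v = h $ j * v $ j"
    using inner_supported[of J _ v] supp J by simp_all
  moreover have "2 * (g $ j * h $ j) \<in> set_of (2 *\<^sub>I (A $ j * B $ j))"
    using g h by (intro scale_in_interval times_in_intervalI) (simp_all add: hyperrect_def)
  ultimately show ?thesis
    by (auto simp: J Lambda_t_def in_multiple_def sqnorm_on_def power2_eq_square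
        algebra_simps intro!: bexI[of _ "2 * (g $ j * h $ j)"])
next
  case False
  define \<beta> where "\<beta> = sqrt (sqsum J A * sqsum J B)"
  obtain w where w: "w \<bullet> w = sqnorm_on J v"
    and gw: "\<And>g. (\<And>i. i \<notin> J \<Longrightarrow> g $ i = 0) \<Longrightarrow> g \<bullet> w = g \<bullet> v"
    using restrict_vector[of J v] by blast
  have n: "norm u = sqrt (sqnorm_on J u)" if "\<And>i. i \<notin> J \<Longrightarrow> u $ i = 0" for u :: "real ^ 'n"
    using inner_supported[of J u u] that
    by (simp add: norm_eq_sqrt_inner sqnorm_on_def power2_eq_square)
  have "norm g \<le> sqrt (sqsum J A)" "norm h \<le> sqrt (sqsum J B)"
    using n[of g] n[of h] supp sqnorm_le_sqsum[OF g, of J] sqnorm_le_sqsum[OF h, of J] by simp_all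
  then have \<beta>: "norm g * norm h \<le> \<beta>"
    unfolding \<beta>_def real_sqrt_mult by (intro mult_mono) (auto simp: sqsum_nonneg)
  have "0 \<le> \<beta>" by (simp add: \<beta>_def sqsum_nonneg)
  have "\<bar>2 * (g \<bullet> w) * (h \<bullet> w) - (g \<bullet> h) * (w \<bullet> w)\<bar> \<le> norm g * norm h * (w \<bullet> w)"
    by (rule two_inner_products_bound)
  also have "\<dots> \<le> \<beta> * (w \<bullet> w)"
    using \<beta> by (intro mult_right_mono) auto
  finally have "in_multiple (2 * (g \<bullet> v) * (h \<bullet> v) - (g \<bullet> h) * sqnorm_on J v)
      (Interval (- \<beta>, \<beta>)) (sqnorm_on J v)"
    using \<open>0 \<le> \<beta>\<close> gw[of g] gw[of h] supp w
    by (simp add: in_multiple_iff sqnorm_on_nonneg bounds_nonneg_Interval) linarith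
  moreover have "in_multiple ((g \<bullet> h) * sqnorm_on J v) (\<Sum>i\<in>J. A $ i * B $ i) (sqnorm_on J v)"
  proof -
    have "(\<Sum>i\<in>J. g $ i * h $ i) \<in> set_of (\<Sum>i\<in>J. A $ i * B $ i)"
      using g h by (intro sum_in_interval times_in_intervalI) (auto simp: hyperrect_def)
    then show ?thesis
      using inner_supported[of J g h] supp unfolding in_multiple_def by auto
  qed
  ultimately have "in_multiple (2 * (g \<bullet> v) * (h \<bullet> v))
      (Interval (- \<beta>, \<beta>) + (\<Sum>i\<in>J. A $ i * B $ i)) (sqnorm_on J v)"
    using in_multiple_plus by fastforce
  then show ?thesis
    using False by (simp add: Lambda_t_def Let_def \<beta>_def)
qed

text \<open>
  The factor on the left is the smaller eigenvalue \<open>\<lambda>\<close> of the matrix with diagonal \<open>a, b\<close> and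
  off-diagonal entries \<open>\<surd>d / 2\<close>.  Shifting by \<open>\<lambda>\<close> leaves diagonal entries \<open>\<alpha>, \<beta> \<ge> 0\<close> with
  \<open>\<alpha> \<beta> = d / 4 \<ge> c\<^sup>2\<close>, so that the mixed term is dominated by the AM-GM inequality.
\<close>

lemma quadratic_form_lower_bound:
  fixes a b c d p q :: real
  assumes "4 * c\<^sup>2 \<le> d"
  shows "(a + b - sqrt ((a - b)\<^sup>2 + d)) / 2 * (p\<^sup>2 + q\<^sup>2) \<le> a * p\<^sup>2 + b * q\<^sup>2 + 2 * c * p * q"
proof -
  define S where "S = sqrt ((a - b)\<^sup>2 + d)"
  have "0 \<le> d"
    using assms by (smt (verit) zero_le_power2)
  have S2: "S\<^sup>2 = (a - b)\<^sup>2 + d"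
    using \<open>0 \<le> d\<close> by (simp add: S_def)
  have "\<bar>a - b\<bar> \<le> S"
    unfolding S_def using \<open>0 \<le> d\<close> by (intro real_le_rsqrt) simp
  define \<alpha> where "\<alpha> = (a - b + S) / 2"
  define \<beta> where "\<beta> = (b - a + S) / 2"
  have nn: "0 \<le> \<alpha>" "0 \<le> \<beta>"
    using \<open>\<bar>a - b\<bar> \<le> S\<close> by (auto simp: \<alpha>_def \<beta>_def)
  have "\<alpha> * \<beta> = d / 4"
    using S2 by (simp add: \<alpha>_def \<beta>_def field_simps power2_eq_square)
  then have "c\<^sup>2 \<le> \<alpha> * \<beta>" using assms by simp
  then have "\<bar>c\<bar> \<le> sqrt \<alpha> * sqrt \<beta>"
    using real_sqrt_le_mono[of "c\<^sup>2" "\<alpha> * \<beta>"] by (simp add: real_sqrt_mult)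
  then have "\<bar>c\<bar> * \<bar>p * q\<bar> \<le> (sqrt \<alpha> * sqrt \<beta>) * \<bar>p * q\<bar>"
    by (intro mult_right_mono) auto
  then have "\<bar>c * p * q\<bar> \<le> (sqrt \<alpha> * \<bar>p\<bar>) * (sqrt \<beta> * \<bar>q\<bar>)"
    by (simp add: abs_mult mult_ac)
  moreover have "2 * (sqrt \<alpha> * \<bar>p\<bar>) * (sqrt \<beta> * \<bar>q\<bar>) \<le> (sqrt \<alpha> * \<bar>p\<bar>)\<^sup>2 + (sqrt \<beta> * \<bar>q\<bar>)\<^sup>2"
    by (rule sum_squares_bound)
  moreover have "(sqrt \<alpha> * \<bar>p\<bar>)\<^sup>2 = \<alpha> * p\<^sup>2" "(sqrt \<beta> * \<bar>q\<bar>)\<^sup>2 = \<beta> * q\<^sup>2"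
    using nn by (simp_all add: power_mult_distrib)
  ultimately have "0 \<le> \<alpha> * p\<^sup>2 + \<beta> * q\<^sup>2 + 2 * (c * p * q)"
    by linarith
  then show ?thesis
    unfolding S_def[symmetric] by (simp add: \<alpha>_def \<beta>_def field_simps)
qed

lemma lower_Lambda_star:
  "lower (Lambda_star A B C) = (lower A + lower B -
     sqrt ((lower A - lower B)\<^sup>2 + 4 * max ((lower C)\<^sup>2) ((upper C)\<^sup>2))) / 2"
  by transfer (auto simp: Let_def)

lemma upper_Lambda_star:
  "upper (Lambda_star A B C) = (upper A + upper B +
     sqrt ((upper A - upper B)\<^sup>2 + 4 * max ((lower C)\<^sup>2) ((upper C)\<^sup>2))) / 2"
  by transfer (auto simp: Let_def)

text \<open>
  The upper bound is the lower bound for the negated form.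
\<close>

lemma two_by_two_form_in_Lambda_star:
  assumes r: "in_multiple r A (p\<^sup>2)" and s: "in_multiple s B (q\<^sup>2)" and c: "c \<in> set_of C"
  shows "in_multiple (r + s + 2 * c * p * q) (Lambda_star A B C) (p\<^sup>2 + q\<^sup>2)"
proof -
  define d where "d = 4 * max ((lower C)\<^sup>2) ((upper C)\<^sup>2)"
  have "4 * c\<^sup>2 \<le> d"
    using c unfolding d_def set_of_eq
    by (cases "0 \<le> c") (auto simp: le_max_iff_disj abs_le_square_iff[symmetric])
  note lo = quadratic_form_lower_bound[OF this, of "lower A" "lower B" p q]
  have "4 * (- c)\<^sup>2 \<le> d" using \<open>4 * c\<^sup>2 \<le> d\<close> by simp
  note up = quadratic_form_lower_bound[OF this, of "- upper A" "- upper B" p q]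
  have *: "(- upper A - - upper B)\<^sup>2 = (upper A - upper B)\<^sup>2"
    by (simp add: power2_eq_square algebra_simps)
  have "(upper A + upper B + sqrt ((upper A - upper B)\<^sup>2 + d)) / 2 * (p\<^sup>2 + q\<^sup>2)
      = - ((- upper A + - upper B - sqrt ((upper A - upper B)\<^sup>2 + d)) / 2 * (p\<^sup>2 + q\<^sup>2))"
    by (simp add: field_simps)
  with lo up r s show ?thesis
    unfolding d_def *
    by (simp add: in_multiple_iff lower_Lambda_star upper_Lambda_star)
qed

section \<open>Second-order derivatives\<close>

text \<open>
  The first two derivatives of \<open>f\<close> at \<open>x\<close>.  The gradient must exist in a whole neighbourhood, as
  otherwise it could not be differentiated at \<open>x\<close>.  The Hessian is a linear map \<open>H\<close> rather than a
  matrix, since it is used only through the inner products \<open>u \<bullet> H v\<close>.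
\<close>

definition has_jet2 ::
    "(real ^ 'n \<Rightarrow> real) \<Rightarrow> real ^ 'n \<Rightarrow> real ^ 'n \<Rightarrow> (real ^ 'n \<Rightarrow> real ^ 'n) \<Rightarrow> bool" where
  "has_jet2 f x g H \<longleftrightarrow>
     (\<exists>G. G x = g \<and> (\<forall>\<^sub>F z in nhds x. (f has_derivative (\<lambda>v. G z \<bullet> v)) (at z)) \<and>
          (G has_derivative H) (at x))"

lemma has_jet2_cong:
  assumes "has_jet2 f x g H" "\<forall>\<^sub>F z in nhds x. f z = f' z"
  shows "has_jet2 f' x g H"
proof -
  from assms(1) obtain G where G: "G x = g"
    "\<forall>\<^sub>F z in nhds x. (f has_derivative (\<lambda>v. G z \<bullet> v)) (at z)" "(G has_derivative H) (at x)"
    by (auto simp: has_jet2_def)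
  have "\<forall>\<^sub>F z in nhds x. \<forall>\<^sub>F u in nhds z. f u = f' u"
    using assms(2) by (simp add: eventually_eventually)
  with G(2) have "\<forall>\<^sub>F z in nhds x. (f' has_derivative (\<lambda>v. G z \<bullet> v)) (at z)"
  proof eventually_elim
    case (elim z)
    have "\<forall>\<^sub>F u in at z. f u = f' u" "f z = f' z"
      using elim(2) eventually_nhds_x_imp_x[OF elim(2)]
      by (auto simp: eventually_at_filter elim: eventually_mono)
    with elim(1) show ?case
      by (metis UNIV_I has_derivative_transform_eventually)
  qed
  with G show ?thesis by (auto simp: has_jet2_def)
qed

lemma has_jet2_component:
  fixes x :: "real ^ 'n"
  shows "has_jet2 (\<lambda>z. z $ i) x (axis i 1) (\<lambda>v. 0)"
  unfolding has_jet2_def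
proof (intro exI[of _ "\<lambda>_. axis i 1"] conjI always_eventually allI)
  fix z :: "real ^ 'n"
  have "((\<lambda>z :: real ^ 'n. z $ i) has_derivative (\<lambda>v. v $ i)) (at z)"
    by (rule bounded_linear_imp_has_derivative[OF bounded_linear_vec_nth])
  then show "((\<lambda>z. z $ i) has_derivative (\<lambda>v. axis i 1 \<bullet> v)) (at z)"
    by (simp add: inner_axis')
qed auto

lemma has_jet2_add:
  assumes "has_jet2 f x g H" "has_jet2 f' x g' H'"
  shows "has_jet2 (\<lambda>z. f z + f' z) x (g + g') (\<lambda>v. H v + H' v)"
proof -
  from assms obtain G G' where G: "G x = g" "G' x = g'"
    and ev: "\<forall>\<^sub>F z in nhds x. (f has_derivative (\<lambda>v. G z \<bullet> v)) (at z)"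
      "\<forall>\<^sub>F z in nhds x. (f' has_derivative (\<lambda>v. G' z \<bullet> v)) (at z)"
    and D: "(G has_derivative H) (at x)" "(G' has_derivative H') (at x)"
    by (auto simp: has_jet2_def)
  have "\<forall>\<^sub>F z in nhds x. ((\<lambda>z. f z + f' z) has_derivative (\<lambda>v. (G z + G' z) \<bullet> v)) (at z)"
    using ev by eventually_elim (simp add: inner_add_left has_derivative_add)
  then show ?thesis
    using G D unfolding has_jet2_def
    by (intro exI[of _ "\<lambda>z. G z + G' z"]) (auto intro: has_derivative_add)
qed

lemma has_jet2_mult:
  assumes "has_jet2 f x g H" "has_jet2 f' x g' H'"
  shows "has_jet2 (\<lambda>z. f z * f' z) x (f' x *\<^sub>R g + f x *\<^sub>R g')
    (\<lambda>v. f' x *\<^sub>R H v + f x *\<^sub>R H' v + (g \<bullet> v) *\<^sub>R g' + (g' \<bullet> v) *\<^sub>R g)"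
proof -
  from assms obtain G G' where G: "G x = g" "G' x = g'"
    and ev: "\<forall>\<^sub>F z in nhds x. (f has_derivative (\<lambda>v. G z \<bullet> v)) (at z)"
      "\<forall>\<^sub>F z in nhds x. (f' has_derivative (\<lambda>v. G' z \<bullet> v)) (at z)"
    and D: "(G has_derivative H) (at x)" "(G' has_derivative H') (at x)"
    by (auto simp: has_jet2_def)
  have "\<forall>\<^sub>F z in nhds x. ((\<lambda>z. f z * f' z) has_derivative
      (\<lambda>v. (f' z *\<^sub>R G z + f z *\<^sub>R G' z) \<bullet> v)) (at z)"
    using ev
  proof eventually_elim
    case (elim z)
    show ?case
      by (rule has_derivative_eq_rhs[OF has_derivative_mult[OF elim]])
        (auto simp: inner_add_left algebra_simps)
  qed
  moreover have "((\<lambda>z. f' z *\<^sub>R G z + f z *\<^sub>R G' z) has_derivative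
     (\<lambda>v. f' x *\<^sub>R H v + f x *\<^sub>R H' v + (g \<bullet> v) *\<^sub>R g' + (g' \<bullet> v) *\<^sub>R g)) (at x)"
  proof -
    have "(f has_derivative (\<lambda>v. g \<bullet> v)) (at x)" "(f' has_derivative (\<lambda>v. g' \<bullet> v)) (at x)"
      using ev[THEN eventually_nhds_x_imp_x] G by auto
    then show ?thesis
      using D G by (auto intro!: derivative_eq_intros simp: algebra_simps)
  qed
  ultimately show ?thesis
    using G unfolding has_jet2_def
    by (intro exI[of _ "\<lambda>z. f' z *\<^sub>R G z + f z *\<^sub>R G' z"]) auto
qed

text \<open>
  The chain rule \<open>\<nabla>\<^sup>2 (\<phi> \<circ> f) = \<phi>' \<nabla>\<^sup>2 f + \<phi>'' \<nabla>f \<nabla>f\<^sup>T\<close>, with all derivatives of \<open>\<phi>\<close> taken at \<open>f x\<close>.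
\<close>

lemma has_jet2_compose:
  assumes "has_jet2 f x g H"
    and ev\<phi>: "\<forall>\<^sub>F s in nhds (f x). (\<phi> has_real_derivative \<phi>' s) (at s)"
    and d2: "(\<phi>' has_real_derivative d2) (at (f x))"
  shows "has_jet2 (\<lambda>z. \<phi> (f z)) x (\<phi>' (f x) *\<^sub>R g)
    (\<lambda>v. \<phi>' (f x) *\<^sub>R H v + (d2 * (g \<bullet> v)) *\<^sub>R g)"
proof -
  from assms(1) obtain G where G: "G x = g"
    and ev: "\<forall>\<^sub>F z in nhds x. (f has_derivative (\<lambda>v. G z \<bullet> v)) (at z)"
    and D: "(G has_derivative H) (at x)"
    by (auto simp: has_jet2_def)
  have fx: "(f has_derivative (\<lambda>v. g \<bullet> v)) (at x)"
    using eventually_nhds_x_imp_x[OF ev] G by simp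
  have "filterlim f (nhds (f x)) (nhds x)"
    using has_derivative_continuous[OF fx] by (simp only: isCont_def tendsto_at_iff_tendsto_nhds)
  then have "\<forall>\<^sub>F z in nhds x. (\<phi> has_real_derivative \<phi>' (f z)) (at (f z))"
    using ev\<phi> by (rule eventually_compose_filterlim[rotated])
  with ev have "\<forall>\<^sub>F z in nhds x. ((\<lambda>z. \<phi> (f z)) has_derivative (\<lambda>v. (\<phi>' (f z) *\<^sub>R G z) \<bullet> v)) (at z)"
  proof eventually_elim
    case (elim z)
    then show ?case
      using has_derivative_compose[OF elim(1), of \<phi> "(*) (\<phi>' (f z))"]
      by (simp add: has_field_derivative_def)
  qed
  moreover have "((\<lambda>z. \<phi>' (f z) *\<^sub>R G z) has_derivative
     (\<lambda>v. \<phi>' (f x) *\<^sub>R H v + (d2 * (g \<bullet> v)) *\<^sub>R g)) (at x)"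
  proof -
    have "((\<lambda>z. \<phi>' (f z)) has_derivative (\<lambda>v. d2 * (g \<bullet> v))) (at x)"
      using has_derivative_compose[OF fx, of \<phi>' "(*) d2"] d2 by (simp add: has_field_derivative_def)
    from has_derivative_scaleR[OF this D] G show ?thesis by (simp add: algebra_simps)
  qed
  ultimately show ?thesis
    using G unfolding has_jet2_def
    by (intro exI[of _ "\<lambda>z. \<phi>' (f z) *\<^sub>R G z"] conjI) (assumption | simp)+
qed

lemma grad_eqI:
  assumes "(f has_derivative (\<lambda>v. g \<bullet> v)) (at z)"
  shows "grad f z = g"
  using frechet_derivative_at[OF assms, symmetric]
  by (simp add: grad_def vec_eq_iff inner_axis)

lemma has_jet2_grad_hessian:
  assumes "has_jet2 f x g H"
  shows "grad f x = g" and "hessian f x *v v = H v"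
proof -
  from assms obtain G where G: "G x = g"
    and ev: "\<forall>\<^sub>F z in nhds x. (f has_derivative (\<lambda>v. G z \<bullet> v)) (at z)"
    and D: "(G has_derivative H) (at x)"
    by (auto simp: has_jet2_def)
  have ev': "\<forall>\<^sub>F z in nhds x. grad f z = G z"
    using ev by eventually_elim (rule grad_eqI)
  from eventually_nhds_x_imp_x[OF this] G show "grad f x = g" by simp
  have "(grad f has_derivative H) (at x)"
    using eventually_nhds_x_imp_x[OF ev'] ev'
    by (intro has_derivative_transform_eventually[OF D])
      (auto simp: eventually_at_filter elim: eventually_mono)
  then have "hessian f x = matrix H" "linear H"
    by (simp_all add: hessian_def jacobian_def has_derivative_linear flip: frechet_derivative_at)
  then show "hessian f x *v v = H v" by (simp add: matrix_works)
qed

section \<open>Eigenvalues of symmetric matrices\<close>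

text \<open>
  A minimiser \<open>v\<close> of a nonnegative form is a critical point.  Concretely, with \<open>w = H v\<close>, moving from
  \<open>v\<close> by \<open>- r w\<close> changes the form to \<open>- 2 r \<parallel>w\<parallel>\<^sup>2 + r\<^sup>2 (w \<bullet> H w)\<close>, which is negative for small
  \<open>r > 0\<close> unless \<open>w = 0\<close>.
\<close>

lemma psd_form_zero_imp_kernel:
  fixes H :: "'a::real_inner \<Rightarrow> 'a"
  assumes lin: "linear H" and sym: "\<And>u v. u \<bullet> H v = v \<bullet> H u"
    and psd: "\<And>v. 0 \<le> v \<bullet> H v" and v: "v \<bullet> H v = 0"
  shows "H v = 0"
proof -
  define w where "w = H v"
  define c where "c = w \<bullet> H w"
  have "0 \<le> c" using psd by (simp add: c_def)
  \<comment> \<open>The denominator \<open>c + 1\<close> instead of \<open>c\<close> avoids a case distinction on \<open>c = 0\<close>.\<close>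
  define r where "r = (w \<bullet> w) / (c + 1)"
  have ww: "w \<bullet> w = r * (c + 1)"
    using \<open>0 \<le> c\<close> by (simp add: r_def)
  have "(v - r *\<^sub>R w) \<bullet> H (v - r *\<^sub>R w) = r\<^sup>2 * c - 2 * r * (w \<bullet> w)"
    using v sym[of v w]
    by (simp add: linear_diff[OF lin] linear_scale[OF lin] inner_diff_left inner_diff_right
        power2_eq_square c_def algebra_simps flip: w_def)
  also have "\<dots> = - (r\<^sup>2 * (c + 2))"
    by (simp add: ww power2_eq_square algebra_simps)
  finally have "r\<^sup>2 * (c + 2) \<le> 0"
    using psd[of "v - r *\<^sub>R w"] by simp
  then have "r = 0"
    using \<open>0 \<le> c\<close> by (simp add: mult_le_0_iff)
  then show ?thesis using ww by (simp add: w_def)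
qed

text \<open>
  Finiteness and nonemptiness are what makes \<open>Min\<close> and \<open>Max\<close> meaningful in the definition of the
  extreme eigenvalues.  Eigenvectors to distinct eigenvalues are orthogonal, hence independent, which
  bounds their number.  The maximum \<open>c\<close> of the form on the unit sphere is an eigenvalue, because the form
  of \<open>c I - A\<close> is nonnegative and vanishes at the maximiser.
\<close>

lemma symmetric_matrix_eigenvalues:
  fixes A :: "real ^ 'n ^ 'n"
  assumes sym: "\<And>u v. u \<bullet> (A *v v) = v \<bullet> (A *v u)"
  shows "finite (eigenvalues A)" and "eigenvalues A \<noteq> {}"
proof -
  have "\<forall>c\<in>eigenvalues A. \<exists>v. v \<noteq> 0 \<and> A *v v = c *\<^sub>R v"
    by (simp add: eigenvalues_def scalar_mult_eq_scaleR)
  then obtain e where e: "e c \<noteq> 0 \<and> A *v e c = c *\<^sub>R e c" if "c \<in> eigenvalues A" for c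
    by metis
  have orth: "orthogonal (e c) (e d)" if "c \<in> eigenvalues A" "d \<in> eigenvalues A" "c \<noteq> d" for c d
  proof -
    have "d * (e c \<bullet> e d) = c * (e c \<bullet> e d)"
      using sym[of "e c" "e d"] e that by (simp add: inner_commute)
    with \<open>c \<noteq> d\<close> show ?thesis by (simp add: orthogonal_def)
  qed
  have inj: "inj_on e (eigenvalues A)"
    using orth e by (auto intro!: inj_onI) (metis orthogonal_self)
  have "independent (e ` eigenvalues A)"
    using orth e by (intro pairwise_orthogonal_independent) (auto simp: pairwise_def)
  then have "finite (e ` eigenvalues A)"
    by (rule independent_imp_finite)
  then show "finite (eigenvalues A)"
    using inj by (simp add: finite_image_iff)
next
  let ?S = "sphere (0 :: real ^ 'n) 1"
  have "axis undefined 1 \<in> ?S" by simp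
  then have "?S \<noteq> {}" by blast
  moreover have "continuous_on ?S (\<lambda>v. v \<bullet> (A *v v))"
    by (intro continuous_intros)
  ultimately obtain v where v: "norm v = 1"
    and max: "\<And>u. norm u = 1 \<Longrightarrow> u \<bullet> (A *v u) \<le> v \<bullet> (A *v v)"
    using continuous_attains_sup[OF compact_sphere, of 0 1 "\<lambda>v. v \<bullet> (A *v v)"] by auto
  define c where "c = v \<bullet> (A *v v)"
  let ?H = "\<lambda>u. c *\<^sub>R u - A *v u"
  have "?H v = 0"
  proof (rule psd_form_zero_imp_kernel[of ?H v])
    show "linear ?H"
      by (intro linear_compose_sub linear_scaleR matrix_vector_mul_linear)
    show "u \<bullet> ?H w = w \<bullet> ?H u" for u w
      using sym[of u w] by (simp add: inner_diff_right inner_commute)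
    have "v \<bullet> v = 1" using v by (simp add: norm_eq_1)
    then show "v \<bullet> ?H v = 0" by (simp add: inner_diff_right c_def)
    show "0 \<le> u \<bullet> ?H u" for u
    proof (cases "u = 0")
      case False
      define w where "w = u /\<^sub>R norm u"
      have u: "u = norm u *\<^sub>R w" using False by (simp add: w_def)
      have "norm w = 1" using False by (simp add: w_def)
      from max[OF this] have "(norm u)\<^sup>2 * (w \<bullet> (A *v w)) \<le> (norm u)\<^sup>2 * c"
        unfolding c_def by (intro mult_left_mono) auto
      moreover have "u \<bullet> (A *v u) = (norm u)\<^sup>2 * (w \<bullet> (A *v w))"
        by (subst (1 2) u) (simp add: matrix_vector_mult_scaleR power2_eq_square)
      ultimately show ?thesis
        by (simp add: inner_diff_right power2_norm_eq_inner mult.commute)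
    qed simp
  qed
  moreover have "v \<noteq> 0" using v by auto
  ultimately have "c \<in> eigenvalues A"
    unfolding eigenvalues_def by (auto simp: scalar_mult_eq_scaleR intro!: exI[of _ v])
  then show "eigenvalues A \<noteq> {}" by blast
qed

text \<open>
  At an eigenvector the form is the eigenvalue times \<open>\<parallel>v\<parallel>\<^sup>2\<close>.
\<close>

lemma eigenvalue_range_subset:
  fixes A :: "real ^ 'n ^ 'n"
  assumes sym: "\<And>u v. u \<bullet> (A *v v) = v \<bullet> (A *v u)"
    and form: "\<And>v. in_multiple (v \<bullet> (A *v v)) \<Lambda> (v \<bullet> v)"
  shows "{lambda_min A..lambda_max A} \<subseteq> set_of \<Lambda>"
proof -
  have "c \<in> set_of \<Lambda>" if "c \<in> eigenvalues A" for c
  proof -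
    from that obtain v where v: "v \<noteq> 0" "A *v v = c *\<^sub>R v"
      by (auto simp: eigenvalues_def scalar_mult_eq_scaleR)
    with form[of v] show ?thesis
      by (auto simp: in_multiple_def)
  qed
  then show ?thesis
    using Min_in[OF symmetric_matrix_eigenvalues[OF sym]]
      Max_in[OF symmetric_matrix_eigenvalues[OF sym]]
    unfolding lambda_min_def lambda_max_def set_of_eq by fastforce
qed

section \<open>Eigenvalue bounds along one operation\<close>

text \<open>
  The invariant of the algorithm, for the value \<open>a\<close>, the gradient \<open>g\<close> and the Hessian \<open>H\<close> of \<open>y\<^sub>k\<close> at
  one fixed point.  The last conjunct says that \<open>H\<close> is concentrated on the coordinates
  outside \<open>\<L>\<^sub>k\<close> and that its eigenvalues there lie in \<open>[\<lambda>\<^sub>k\<^sup>\<dagger>]\<close>.  The inclusion \<open>\<I>\<^sub>k \<subseteq> \<L>\<^sub>k\<close>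
  reflects that \<open>y\<^sub>k\<close> is affine in every variable on which it does not depend; it lets a
  nonlinear operation set \<open>\<L>\<^sub>k\<close> from \<open>\<I>\<^sub>i\<close> alone.
\<close>

definition encloses ::
    "'n node \<Rightarrow> real \<Rightarrow> real ^ 'n \<Rightarrow> (real ^ 'n \<Rightarrow> real ^ 'n) \<Rightarrow> bool" where
  "encloses P a g H \<longleftrightarrow>
     a \<in> set_of (nY P) \<and> g \<in> hyperrect (nG P) \<and> (\<forall>i\<in>nI P. g $ i = 0) \<and> nI P \<subseteq> nL P \<and>
     (\<forall>u v. u \<bullet> H v = v \<bullet> H u) \<and>
     (\<forall>v. in_multiple (v \<bullet> H v) (nLam P) (sqnorm_on (- nL P) v))"

text \<open>
  Let \<open>J\<^sub>i\<close> and \<open>J\<^sub>j\<close> be the complements of \<open>\<L>\<^sub>i\<close> and \<open>\<L>\<^sub>j\<close>.  A summand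
  whose set is the whole of \<open>J\<^sub>i \<union> J\<^sub>j\<close> keeps its interval, one with a smaller set needs \<open>0\<close> adjoined,
  one with an empty set vanishes, and if \<open>J\<^sub>i\<close> and \<open>J\<^sub>j\<close> are disjoint the sum is block diagonal, so that the hull suffices.
\<close>

lemma lam_add_sound:
  assumes p: "in_multiple p (nLam P) (sqnorm_on (- nL P) v)"
    and q: "in_multiple q (nLam Q) (sqnorm_on (- nL Q) v)"
  shows "in_multiple (p + q) (lam_add P Q) (sqnorm_on (- (nL P \<inter> nL Q)) v)"
proof -
  let ?Li = "nL P" and ?Lj = "nL Q"
  define s where "s = sqnorm_on (- (?Li \<inter> ?Lj)) v"
  have le: "sqnorm_on (- ?Li) v \<le> s" "sqnorm_on (- ?Lj) v \<le> s"
    unfolding s_def by (auto intro!: sqnorm_on_mono)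
  have p0: "in_multiple p (hull0 (nLam P)) s" and q0: "in_multiple q (hull0 (nLam Q)) s"
    using p q le by (auto intro: in_multiple_hull0 sqnorm_on_nonneg)
  have pL: "in_multiple p (nLam P) s" if "?Li \<subseteq> ?Lj"
    using p that by (simp add: s_def Int_absorb2)
  have qL: "in_multiple q (nLam Q) s" if "?Lj \<subseteq> ?Li"
    using q that by (simp add: s_def Int_absorb1)
  have pU: "p = 0" if "?Li = UNIV" using p that in_multiple_zero by auto
  have qU: "q = 0" if "?Lj = UNIV" using q that in_multiple_zero by auto
  consider "?Li = UNIV" "?Lj = UNIV"
    | "?Li \<noteq> UNIV" "?Lj = UNIV"
    | "?Li = UNIV" "?Lj \<noteq> UNIV"
    | "?Li \<noteq> UNIV" "?Lj \<noteq> UNIV" "?Li \<union> ?Lj = UNIV"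
    | "?Li \<union> ?Lj \<noteq> UNIV" "?Li = ?Lj"
    | "?Li \<union> ?Lj \<noteq> UNIV" "?Li \<subset> ?Lj"
    | "?Li \<union> ?Lj \<noteq> UNIV" "?Lj \<subset> ?Li" "\<not> ?Li \<subseteq> ?Lj" "?Li \<noteq> ?Lj"
    | "?Li \<union> ?Lj \<noteq> UNIV" "\<not> ?Li \<subseteq> ?Lj" "\<not> ?Lj \<subseteq> ?Li" "?Li \<noteq> ?Lj"
    unfolding psubset_eq by argo
  then have "in_multiple (p + q) (lam_add P Q) s"
  proof cases
    case 1
    then show ?thesis using pU qU by (simp add: lam_add_def in_multiple_def)
  next
    case 2
    then show ?thesis using pL qU by (simp add: lam_add_def Let_def psubset_eq)
  next
    case 3
    then show ?thesis using qL pU by (simp add: lam_add_def Let_def psubset_eq)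
  next
    case 4
    have "s = sqnorm_on (- ?Li) v + sqnorm_on (- ?Lj) v"
      unfolding s_def Compl_Int using 4 by (intro sqnorm_on_Un) auto
    then have "in_multiple (p + q) (sup (nLam P) (nLam Q)) s"
      using in_multiple_sup[OF p q] sqnorm_on_nonneg by auto
    with 4 show ?thesis by (simp add: lam_add_def)
  next
    case 5
    then have "?Li \<noteq> UNIV" "?Lj \<noteq> UNIV" by auto
    with 5 have "lam_add P Q = nLam P + nLam Q" by (simp add: lam_add_def Let_def psubset_eq)
    with 5 show ?thesis using in_multiple_plus[OF pL qL] by simp
  next
    case 6
    then have "?Li \<noteq> UNIV" "?Lj \<noteq> UNIV" by auto
    with 6 have "lam_add P Q = nLam P + hull0 (nLam Q)" by (simp add: lam_add_def Let_def psubset_eq)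
    with 6 show ?thesis using in_multiple_plus[OF pL q0] by auto
  next
    case 7
    then have "?Li \<noteq> UNIV" "?Lj \<noteq> UNIV" by auto
    with 7 have "lam_add P Q = hull0 (nLam P) + nLam Q" by (simp add: lam_add_def Let_def psubset_eq)
    with 7 show ?thesis using in_multiple_plus[OF p0 qL] by auto
  next
    case 8
    then have "?Li \<noteq> UNIV" "?Lj \<noteq> UNIV" by auto
    with 8 have "lam_add P Q = hull0 (nLam P) + hull0 (nLam Q)" by (simp add: lam_add_def Let_def psubset_eq)
    then show ?thesis using in_multiple_plus[OF p0 q0] by simp
  qed
  then show ?thesis by (simp add: s_def)
qed

lemma card_pred_imp_Compl_singleton:
  fixes J :: "'n::finite set"
  assumes "card J = CARD('n) - 1"
  obtains p where "- J = {p}"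
proof -
  have "0 < CARD('n)" by simp
  then have "card (- J) = 1" using assms by (simp add: Compl_eq_Diff_UNIV card_Diff_subset)
  then show ?thesis using that by (auto simp: card_1_singleton_iff)
qed

text \<open>
  The Hessian of a product is \<open>b H + a K + (g h\<^sup>T + h g\<^sup>T)\<close>.  In general the last summand contributes
  \<open>\<Lambda>\<^sub>t\<close>, and the first two are handled as in a sum, the coordinates outside
  \<open>\<I>\<^sub>i \<inter> \<I>\<^sub>j\<close> now being able to form a strictly larger set than those on which \<open>H\<close> and \<open>K\<close> live.
  Under \<open>C\<^sub>\<star>\<close> the factors depend on one variable each, and on different ones; the whole Hessian is then
  a \<open>2 \<times> 2\<close> matrix, for which the eigenvalue formula \<open>\<Lambda>\<^sub>\<star>\<close> is sharper.
\<close>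

lemma lam_mul_sound:
  fixes P Q :: "'n::finite node"
  assumes P: "encloses P a g H" and Q: "encloses Q b h K"
  shows "in_multiple (b * (v \<bullet> H v) + a * (v \<bullet> K v) + 2 * (g \<bullet> v) * (h \<bullet> v))
    (lam_mul P Q (nI P \<inter> nI Q)) (sqnorm_on (- (nI P \<inter> nI Q)) v)"
proof -
  let ?Ii = "nI P" and ?Ij = "nI Q" and ?Li = "nL P" and ?Lj = "nL Q"
  define Lk where "Lk = ?Ii \<inter> ?Ij"
  define s where "s = sqnorm_on (- Lk) v"
  define A where "A = nY Q * nLam P"
  define A0 where "A0 = nY Q * hull0 (nLam P)"
  define B where "B = nY P * nLam Q"
  define B0 where "B0 = nY P * hull0 (nLam Q)"
  define lt where "lt = Lambda_t (- Lk) (nG P) (nG Q)"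
  define \<gamma> where "\<gamma> = nG P $ the_elem (- ?Ii) * nG Q $ the_elem (- ?Ij)"
  define C where "C \<longleftrightarrow> ?Ii \<union> ?Ij = UNIV \<and> card ?Ii = CARD('n) - 1 \<and> card ?Ij = CARD('n) - 1"
  define p where "p = b * (v \<bullet> H v)"
  define q where "q = a * (v \<bullet> K v)"
  note defs = A_def B_def A0_def B0_def lt_def \<gamma>_def C_def
  have a: "a \<in> set_of (nY P)" and b: "b \<in> set_of (nY Q)"
    and g: "g \<in> hyperrect (nG P)" and h: "h \<in> hyperrect (nG Q)"
    and gI: "\<And>i. i \<in> ?Ii \<Longrightarrow> g $ i = 0" and hI: "\<And>i. i \<in> ?Ij \<Longrightarrow> h $ i = 0"
    and IL: "?Ii \<subseteq> ?Li" "?Ij \<subseteq> ?Lj"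
    and H: "in_multiple (v \<bullet> H v) (nLam P) (sqnorm_on (- ?Li) v)"
    and K: "in_multiple (v \<bullet> K v) (nLam Q) (sqnorm_on (- ?Lj) v)"
    using P Q by (auto simp: encloses_def)
  have T: "in_multiple (2 * (g \<bullet> v) * (h \<bullet> v)) lt s"
    unfolding lt_def s_def by (rule inner_product_in_Lambda_t) (use g h gI hI in \<open>auto simp: Lk_def\<close>)
  have pA: "in_multiple p A (sqnorm_on (- ?Li) v)" and qB: "in_multiple q B (sqnorm_on (- ?Lj) v)"
    using H K a b by (auto simp: p_def q_def A_def B_def intro: in_multiple_times)
  have pA0: "in_multiple p A0 r" if "sqnorm_on (- ?Li) v \<le> r" for r
    unfolding p_def A0_def using that by (intro in_multiple_times b in_multiple_hull0[OF H] sqnorm_on_nonneg)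
  have qB0: "in_multiple q B0 r" if "sqnorm_on (- ?Lj) v \<le> r" for r
    unfolding q_def B0_def using that by (intro in_multiple_times a in_multiple_hull0[OF K] sqnorm_on_nonneg)
  have le: "sqnorm_on (- ?Li) v \<le> s" "sqnorm_on (- ?Lj) v \<le> s"
    unfolding s_def using IL by (auto simp: Lk_def intro!: sqnorm_on_mono)
  have LkL: "Lk \<subseteq> ?Li" "Lk \<subseteq> ?Lj" using IL by (auto simp: Lk_def)
  have pU: "p = 0" if "?Li = UNIV" using H that in_multiple_zero by (auto simp: p_def)
  have qU: "q = 0" if "?Lj = UNIV" using K that in_multiple_zero by (auto simp: q_def)
  have pAk: "in_multiple p A s" if "Lk = ?Li" using pA that by (simp add: s_def)
  have qBk: "in_multiple q B s" if "Lk = ?Lj" using qB that by (simp add: s_def)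

  \<comment> \<open>A factor that is affine in its only variable has vanishing Hessian, which gives a zero diagonal entry.\<close>
  have star: "in_multiple (p + q + 2 * (g \<bullet> v) * (h \<bullet> v))
      (Lambda_star (if ?Li = UNIV then 0 else A) (if ?Lj = UNIV then 0 else B) \<gamma>) s" if C
  proof -
    obtain i j where ij: "- ?Ii = {i}" "- ?Ij = {j}"
      using \<open>C\<close> card_pred_imp_Compl_singleton unfolding C_def by metis
    have "i \<noteq> j" using \<open>C\<close> ij unfolding C_def by blast
    have "- Lk = {i, j}" using ij by (auto simp: Lk_def)
    then have s: "s = (v $ i)\<^sup>2 + (v $ j)\<^sup>2"
      using \<open>i \<noteq> j\<close> by (simp add: s_def sqnorm_on_def)
    have "g $ k = 0" if "k \<notin> {i}" for k using gI[of k] that ij(1) by blast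
    then have gv: "g \<bullet> v = g $ i * v $ i"
      using inner_supported[of "{i}" g v] by simp
    have "h $ k = 0" if "k \<notin> {j}" for k using hI[of k] that ij(2) by blast
    then have hv: "h \<bullet> v = h $ j * v $ j"
      using inner_supported[of "{j}" h v] by simp
    have "- ?Li \<subseteq> {i}" "- ?Lj \<subseteq> {j}" using IL ij by auto
    then have "- ?Li = {} \<or> - ?Li = {i}" "- ?Lj = {} \<or> - ?Lj = {j}"
      by (simp_all add: subset_singleton_iff)
    then have "?Li \<noteq> UNIV \<longrightarrow> sqnorm_on (- ?Li) v = (v $ i)\<^sup>2"
      "?Lj \<noteq> UNIV \<longrightarrow> sqnorm_on (- ?Lj) v = (v $ j)\<^sup>2"
      by (auto simp: sqnorm_on_def)
    then have "in_multiple p (if ?Li = UNIV then 0 else A) ((v $ i)\<^sup>2)"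
      and "in_multiple q (if ?Lj = UNIV then 0 else B) ((v $ j)\<^sup>2)"
      using pA pU qB qU
      by (cases "?Li = UNIV", simp_all add: in_multiple_def[of 0 0])
        (cases "?Lj = UNIV", simp_all add: in_multiple_def[of 0 0])
    moreover have "g $ i * h $ j \<in> set_of \<gamma>"
      unfolding \<gamma>_def ij using g h by (auto simp: hyperrect_def intro: times_in_intervalI)
    moreover have "2 * (g \<bullet> v) * (h \<bullet> v) = 2 * (g $ i * h $ j) * v $ i * v $ j"
      by (simp add: gv hv)
    ultimately show ?thesis
      unfolding s by (simp only: two_by_two_form_in_Lambda_star)
  qed

  \<comment> \<open>It remains to bound \<open>b H + a K\<close> in all the other cases.\<close>
  have sum: "in_multiple (p + q + 2 * (g \<bullet> v) * (h \<bullet> v)) L s"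
    if "L = lt + M" "in_multiple (p + q) M s" for L M
    using in_multiple_plus[OF T that(2)] that(1) by (simp add: add.commute)

  have lam: "lam_mul P Q Lk =
     (if ?Li = UNIV \<and> ?Lj = UNIV then lt
      else if ?Li \<subset> UNIV \<and> ?Lj = UNIV then
        (if Lk = ?Li then lt + A else if \<not> C then lt + A0 else Lambda_star A 0 \<gamma>)
      else if ?Lj \<subset> UNIV \<and> ?Li = UNIV then
        (if Lk = ?Lj then lt + B else if \<not> C then lt + B0 else Lambda_star 0 B \<gamma>)
      else if C then Lambda_star A B \<gamma>
      else if ?Li \<union> ?Lj = UNIV then
        (if Lk \<subset> ?Li \<inter> ?Lj then lt + sup (sup A B) 0 else lt + sup A B)
      else if Lk = ?Li \<and> ?Li = ?Lj then lt + A + B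
      else if Lk = ?Li \<and> ?Li \<subset> ?Lj then lt + A + B0
      else if Lk = ?Lj \<and> ?Lj \<subset> ?Li then lt + A0 + B
      else if Lk \<subset> ?Li \<and> ?Li = ?Lj then lt + sup (A + B) 0
      else if Lk \<subset> ?Li \<and> ?Li \<subset> ?Lj then lt + sup (A + B0) 0
      else if Lk \<subset> ?Lj \<and> ?Lj \<subset> ?Li then lt + sup (A0 + B) 0
      else lt + A0 + B0)"
    unfolding lam_mul_def Let_def defs ..

  have "in_multiple (p + q + 2 * (g \<bullet> v) * (h \<bullet> v)) (lam_mul P Q Lk) s"
  proof (cases "?Li = UNIV \<or> ?Lj = UNIV")
    case True
    then consider "?Li = UNIV" "?Lj = UNIV"
      | "?Li \<noteq> UNIV" "?Lj = UNIV" "Lk = ?Li"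
      | "?Li \<noteq> UNIV" "?Lj = UNIV" "Lk \<noteq> ?Li" "\<not> C"
      | "?Li \<noteq> UNIV" "?Lj = UNIV" "Lk \<noteq> ?Li" C
      | "?Li = UNIV" "?Lj \<noteq> UNIV" "Lk = ?Lj"
      | "?Li = UNIV" "?Lj \<noteq> UNIV" "Lk \<noteq> ?Lj" "\<not> C"
      | "?Li = UNIV" "?Lj \<noteq> UNIV" "Lk \<noteq> ?Lj" C
      by argo
    then show ?thesis
    proof cases
      case 1
      have "lam_mul P Q Lk = lt"
        unfolding lam using 1 by (simp add: psubset_eq add.assoc)
      then show ?thesis using T pU qU 1 by simp
    next
      case 2
      have "lam_mul P Q Lk = lt + A"
        unfolding lam using 2 by (simp add: psubset_eq add.assoc)
      then show ?thesis by (rule sum) (use 2 qU pAk in simp)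
    next
      case 3
      have "lam_mul P Q Lk = lt + A0"
        unfolding lam using 3 by (simp add: psubset_eq add.assoc)
      then show ?thesis by (rule sum) (use 3 qU pA0 le in simp)
    next
      case 4
      have "lam_mul P Q Lk = Lambda_star A 0 \<gamma>"
        unfolding lam using 4 by (simp add: psubset_eq add.assoc)
      then show ?thesis using star 4 by simp
    next
      case 5
      have "lam_mul P Q Lk = lt + B"
        unfolding lam using 5 by (simp add: psubset_eq add.assoc)
      then show ?thesis by (rule sum) (use 5 pU qBk in simp)
    next
      case 6
      have "lam_mul P Q Lk = lt + B0"
        unfolding lam using 6 by (simp add: psubset_eq add.assoc)
      then show ?thesis by (rule sum) (use 6 pU qB0 le in simp)
    next
      case 7
      have "lam_mul P Q Lk = Lambda_star 0 B \<gamma>"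
        unfolding lam using 7 by (simp add: psubset_eq add.assoc)
      then show ?thesis using star 7 by simp
    qed
  next
    case nU: False
    then consider C
      | "\<not> C" "?Li \<union> ?Lj = UNIV" "Lk \<subset> ?Li \<inter> ?Lj"
      | "\<not> C" "?Li \<union> ?Lj = UNIV" "Lk = ?Li \<inter> ?Lj"
      | "\<not> C" "?Li \<union> ?Lj \<noteq> UNIV" "Lk = ?Li" "?Li = ?Lj"
      | "\<not> C" "?Li \<union> ?Lj \<noteq> UNIV" "Lk = ?Li" "?Li \<subset> ?Lj"
      | "\<not> C" "?Li \<union> ?Lj \<noteq> UNIV" "Lk = ?Lj" "?Lj \<subset> ?Li" "?Li \<noteq> ?Lj"
      | "\<not> C" "?Li \<union> ?Lj \<noteq> UNIV" "Lk \<subset> ?Li" "?Li = ?Lj"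
      | "\<not> C" "?Li \<union> ?Lj \<noteq> UNIV" "Lk \<subset> ?Li" "?Li \<subset> ?Lj" "\<not> ?Lj \<subseteq> ?Li"
      | "\<not> C" "?Li \<union> ?Lj \<noteq> UNIV" "Lk \<subset> ?Lj" "?Lj \<subset> ?Li" "?Li \<noteq> ?Lj" "\<not> ?Li \<subseteq> ?Lj"
      | "\<not> C" "?Li \<union> ?Lj \<noteq> UNIV" "\<not> ?Li \<subseteq> ?Lj" "\<not> ?Lj \<subseteq> ?Li" "?Li \<noteq> ?Lj"
      using LkL Int_greatest[OF LkL] set_eq_subset[of ?Li ?Lj] unfolding psubset_eq by argo
    then show ?thesis
    proof cases
      case 1
      have "lam_mul P Q Lk = Lambda_star A B \<gamma>"
        unfolding lam using 1 nU by (simp add: psubset_eq add.assoc)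
      then show ?thesis using star 1 nU by simp
    next
      case 2
      have eq: "lam_mul P Q Lk = lt + hull0 (sup A B)"
        unfolding lam hull0_def using 2 nU by (simp add: psubset_eq add.assoc)
      have "sqnorm_on (- ?Li) v + sqnorm_on (- ?Lj) v = sqnorm_on (- ?Li \<union> - ?Lj) v"
        using 2 by (intro sqnorm_on_Un[symmetric]) auto
      also have "\<dots> \<le> s"
        unfolding s_def using 2 by (intro sqnorm_on_mono) auto
      finally have "in_multiple (p + q) (hull0 (sup A B)) s"
        using in_multiple_sup[OF pA qB] by (intro in_multiple_hull0) (auto simp: sqnorm_on_nonneg)
      with eq show ?thesis by (rule sum)
    next
      case 3
      have eq: "lam_mul P Q Lk = lt + sup A B"
        unfolding lam using 3 nU by (simp add: psubset_eq add.assoc)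
      have "s = sqnorm_on (- ?Li) v + sqnorm_on (- ?Lj) v"
        unfolding s_def 3 Compl_Int using 3 by (intro sqnorm_on_Un) auto
      then have "in_multiple (p + q) (sup A B) s"
        using in_multiple_sup[OF pA qB] by (simp add: sqnorm_on_nonneg)
      with eq show ?thesis by (rule sum)
    next
      case 4
      have "lam_mul P Q Lk = lt + (A + B)"
        unfolding lam using 4 nU by (simp add: psubset_eq add.assoc)
      then show ?thesis by (rule sum) (use 4 pAk qBk in \<open>simp add: in_multiple_plus\<close>)
    next
      case 5
      have "lam_mul P Q Lk = lt + (A + B0)"
        unfolding lam using 5 nU by (simp add: psubset_eq add.assoc)
      then show ?thesis by (rule sum) (use 5 pAk qB0 le in \<open>simp add: in_multiple_plus\<close>)
    next
      case 6
      have "lam_mul P Q Lk = lt + (A0 + B)"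
        unfolding lam using 6 nU by (simp add: psubset_eq add.assoc)
      then show ?thesis by (rule sum) (use 6 pA0 qBk le in \<open>simp add: in_multiple_plus\<close>)
    next
      case 7
      have eq: "lam_mul P Q Lk = lt + hull0 (A + B)"
        unfolding lam hull0_def using 7 nU by (simp add: psubset_eq add.assoc)
      have "in_multiple (p + q) (A + B) (sqnorm_on (- ?Li) v)"
        using pA qB 7 by (intro in_multiple_plus) simp_all
      from sum[OF eq in_multiple_hull0[OF this sqnorm_on_nonneg le(1)]] show ?thesis .
    next
      case 8
      have eq: "lam_mul P Q Lk = lt + hull0 (A + B0)"
        unfolding lam hull0_def using 8 nU by (simp add: psubset_eq add.assoc)
      have "in_multiple (p + q) (A + B0) (sqnorm_on (- ?Li) v)"
        using 8 by (intro in_multiple_plus pA qB0 sqnorm_on_mono) auto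
      from sum[OF eq in_multiple_hull0[OF this sqnorm_on_nonneg le(1)]] show ?thesis .
    next
      case 9
      have eq: "lam_mul P Q Lk = lt + hull0 (A0 + B)"
        unfolding lam hull0_def using 9 nU by (simp add: psubset_eq add.assoc)
      have "in_multiple (p + q) (A0 + B) (sqnorm_on (- ?Lj) v)"
        using 9 by (intro in_multiple_plus pA0 qB sqnorm_on_mono) auto
      from sum[OF eq in_multiple_hull0[OF this sqnorm_on_nonneg le(2)]] show ?thesis .
    next
      case 10
      have "lam_mul P Q Lk = lt + (A0 + B0)"
        unfolding lam using 10 nU by (simp add: psubset_eq add.assoc)
      then show ?thesis by (rule sum) (intro in_multiple_plus pA0 qB0 le)
    qed
  qed
  then show ?thesis by (simp add: Lk_def s_def p_def q_def)
qed

lemma encloses_init_node: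
  assumes "x \<in> hyperrect X"
  shows "encloses (init_node idx X k) (x $ idx k) (axis (idx k) 1) (\<lambda>v. 0)"
  using assms by (auto simp: encloses_def init_node_def hyperrect_def axis_def in_multiple_def)

lemma encloses_add:
  assumes "encloses (S i) a g H" "encloses (S j) b h K"
  shows "encloses (step_node S (AddOp i j)) (a + b) (g + h) (\<lambda>v. H v + K v)"
proof -
  have "in_multiple (v \<bullet> (H v + K v)) (lam_add (S i) (S j)) (sqnorm_on (- (nL (S i) \<inter> nL (S j))) v)" for v
    unfolding inner_add_right
    by (rule lam_add_sound) (use assms in \<open>simp_all add: encloses_def\<close>)
  then show ?thesis
    using assms
    by (auto simp: encloses_def step_node_def Let_def hyperrect_def inner_add_right
        intro!: plus_in_intervalI)
qed

lemma encloses_mul: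
  assumes "encloses (S i) a g H" "encloses (S j) b h K"
  shows "encloses (step_node S (MulOp i j)) (a * b) (b *\<^sub>R g + a *\<^sub>R h)
    (\<lambda>v. b *\<^sub>R H v + a *\<^sub>R K v + (g \<bullet> v) *\<^sub>R h + (h \<bullet> v) *\<^sub>R g)"
proof -
  have "in_multiple (v \<bullet> (b *\<^sub>R H v + a *\<^sub>R K v + (g \<bullet> v) *\<^sub>R h + (h \<bullet> v) *\<^sub>R g))
     (lam_mul (S i) (S j) (nI (S i) \<inter> nI (S j))) (sqnorm_on (- (nI (S i) \<inter> nI (S j))) v)" for v
    using lam_mul_sound[OF assms, of v]
    by (simp add: inner_add_right inner_commute algebra_simps del: compl_inf)
  moreover have "u \<bullet> (b *\<^sub>R H v + a *\<^sub>R K v + (g \<bullet> v) *\<^sub>R h + (h \<bullet> v) *\<^sub>R g)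
      = v \<bullet> (b *\<^sub>R H u + a *\<^sub>R K u + (g \<bullet> u) *\<^sub>R h + (h \<bullet> u) *\<^sub>R g)" for u v
  proof -
    have "u \<bullet> H v = v \<bullet> H u" "u \<bullet> K v = v \<bullet> K u"
      using assms by (auto simp: encloses_def)
    then show ?thesis by (simp add: inner_add_right inner_commute)
  qed
  ultimately show ?thesis
    using assms
    by (auto simp: encloses_def step_node_def Let_def hyperrect_def simp del: compl_inf
        intro!: plus_in_intervalI times_in_intervalI)
qed

lemma encloses_addC:
  assumes "encloses (S i) a g H"
  shows "encloses (step_node S (AddCOp i c)) (a + c) g H"
  using assms
  by (auto simp: encloses_def step_node_def plus_in_intervalI in_multiple_def)

lemma encloses_mulByC:
  assumes "encloses (S i) a g H"
  shows "encloses (step_node S (MulByCOp c i)) (c * a) (c *\<^sub>R g) (\<lambda>v. c *\<^sub>R H v)"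
  using assms
  by (auto simp: encloses_def step_node_def hyperrect_def scale_in_interval in_multiple_zero
      intro: in_multiple_times) (auto simp: in_multiple_def)

text \<open>
  By the chain rule the form is \<open>d1 (v \<bullet> H v) + d2 (g \<bullet> v)\<^sup>2\<close>, and both summands are multiples of the
  same partial norm \<open>\<parallel>v\<parallel>\<^sup>2\<close> over the complement of \<open>\<I>\<^sub>i\<close>: the first by \<open>d1 \<mu>\<close> with \<open>\<mu>\<close> in
  \<open>[\<mu>]\<close> (or by \<open>0\<close> if \<open>\<L>\<^sub>i = \<N>\<close>), the second by \<open>d2 s\<close> with \<open>s\<close> in \<open>\<Lambda>\<^sub>s\<close>.  What remains for each operation is that its formula
  for \<open>[\<lambda>\<^sub>k\<^sup>\<dagger>]\<close> contains the resulting factor.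
\<close>

lemma encloses_unary:
  fixes P :: "'n::finite node"
  assumes P: "encloses P a g H"
    and "b \<in> set_of Y" and d1: "d1 \<in> set_of D"
    and \<Lambda>1: "\<And>s. nL P = UNIV \<Longrightarrow> s \<in> set_of (Lambda_s (- nI P) (nG P)) \<Longrightarrow> d2 * s \<in> set_of \<Lambda>"
    and \<Lambda>2: "\<And>s \<mu>. nL P \<noteq> UNIV \<Longrightarrow> s \<in> set_of (Lambda_s (- nI P) (nG P)) \<Longrightarrow>
        \<mu> \<in> set_of (lam_mu P (nI P)) \<Longrightarrow> d2 * s + d1 * \<mu> \<in> set_of \<Lambda>"
  shows "encloses \<lparr>nI = nI P, nL = nI P, nY = Y, nG = D *s nG P, nLam = \<Lambda>\<rparr> b (d1 *\<^sub>R g)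
    (\<lambda>v. d1 *\<^sub>R H v + (d2 * (g \<bullet> v)) *\<^sub>R g)"
proof -
  have g: "g \<in> hyperrect (nG P)" and gI: "\<And>i. i \<in> nI P \<Longrightarrow> g $ i = 0"
    and IL: "nI P \<subseteq> nL P" and sym: "\<And>u v. u \<bullet> H v = v \<bullet> H u"
    and H: "\<And>v. in_multiple (v \<bullet> H v) (nLam P) (sqnorm_on (- nL P) v)"
    using P by (auto simp: encloses_def)
  have "in_multiple (v \<bullet> (d1 *\<^sub>R H v + (d2 * (g \<bullet> v)) *\<^sub>R g)) \<Lambda> (sqnorm_on (- nI P) v)" for v
  proof -
    define r where "r = sqnorm_on (- nI P) v"
    have "in_multiple ((g \<bullet> v)\<^sup>2) (Lambda_s (- nI P) (nG P)) r"
      unfolding r_def using g gI by (intro square_inner_in_Lambda_s) auto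
    then obtain s where s: "s \<in> set_of (Lambda_s (- nI P) (nG P))" "(g \<bullet> v)\<^sup>2 = s * r"
      by (auto simp: in_multiple_def)
    have eq: "v \<bullet> (d1 *\<^sub>R H v + (d2 * (g \<bullet> v)) *\<^sub>R g) = d1 * (v \<bullet> H v) + d2 * (s * r)"
      by (simp add: inner_add_right inner_commute power2_eq_square flip: s(2))
    show ?thesis
    proof (cases "nL P = UNIV")
      case True
      then have "v \<bullet> H v = 0" using H[of v] in_multiple_zero by simp
      then show ?thesis
        using \<Lambda>1[OF True s(1)] eq unfolding in_multiple_def r_def[symmetric]
        by (intro bexI[of _ "d2 * s"]) simp_all
    next
      case False
      have "in_multiple (v \<bullet> H v) (lam_mu P (nI P)) r"
      proof (cases "nI P = nL P")
        case True
        then show ?thesis using H[of v] by (simp add: lam_mu_def r_def)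
      next
        case False
        have "sqnorm_on (- nL P) v \<le> r"
          unfolding r_def using IL by (intro sqnorm_on_mono) auto
        then show ?thesis
          using False H[of v] by (auto simp: lam_mu_def intro: in_multiple_hull0 sqnorm_on_nonneg)
      qed
      then obtain \<mu> where \<mu>: "\<mu> \<in> set_of (lam_mu P (nI P))" "v \<bullet> H v = \<mu> * r"
        by (auto simp: in_multiple_def)
      show ?thesis
        using \<Lambda>2[OF False s(1) \<mu>(1)] unfolding in_multiple_def r_def[symmetric] eq \<mu>(2)
        by (intro bexI[of _ "d2 * s + d1 * \<mu>"]) (simp_all add: algebra_simps)
    qed
  qed
  moreover have "u \<bullet> (d1 *\<^sub>R H v + (d2 * (g \<bullet> v)) *\<^sub>R g) = v \<bullet> (d1 *\<^sub>R H u + (d2 * (g \<bullet> u)) *\<^sub>R g)" for u v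
    using sym[of u v] by (simp add: inner_add_right inner_commute)
  ultimately show ?thesis
    using assms(2) d1 g gI by (auto simp: encloses_def hyperrect_def intro: times_in_intervalI)
qed

section \<open>Derivatives along one operation\<close>

definition tracks ::
    "'n node \<Rightarrow> (real ^ 'n \<Rightarrow> real) \<Rightarrow> real ^ 'n \<Rightarrow> bool" where
  "tracks P f x \<longleftrightarrow> (\<exists>g H. has_jet2 f x g H \<and> encloses P (f x) g H)"

lemma tracks_unary:
  fixes P :: "'n::finite node"
  assumes "tracks P f x"
    and ev: "\<forall>\<^sub>F s in nhds (f x). (\<phi> has_real_derivative \<phi>' s) (at s)"
    and d2: "(\<phi>' has_real_derivative d2) (at (f x))"
    and "\<phi> (f x) \<in> set_of Y" and "\<phi>' (f x) \<in> set_of D"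
    and "\<And>s. nL P = UNIV \<Longrightarrow> s \<in> set_of (Lambda_s (- nI P) (nG P)) \<Longrightarrow> d2 * s \<in> set_of \<Lambda>"
    and "\<And>s \<mu>. nL P \<noteq> UNIV \<Longrightarrow> s \<in> set_of (Lambda_s (- nI P) (nG P)) \<Longrightarrow>
        \<mu> \<in> set_of (lam_mu P (nI P)) \<Longrightarrow> d2 * s + \<phi>' (f x) * \<mu> \<in> set_of \<Lambda>"
  shows "tracks \<lparr>nI = nI P, nL = nI P, nY = Y, nG = D *s nG P, nLam = \<Lambda>\<rparr> (\<lambda>z. \<phi> (f z)) x"
proof -
  from assms(1) obtain g H where "has_jet2 f x g H" and "encloses P (f x) g H"
    by (auto simp: tracks_def)
  from has_jet2_compose[OF this(1) ev d2] encloses_unary[OF this(2) assms(4-7)]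
  show ?thesis unfolding tracks_def by blast
qed

lemma tracks_nY: "tracks P f x \<Longrightarrow> f x \<in> set_of (nY P)"
  by (auto simp: tracks_def encloses_def)

lemma tracks_powNat:
  assumes f: "tracks (S i) f x" and "2 \<le> m"
  shows "tracks (step_node S (PowNatOp i m)) (\<lambda>z. f z ^ m) x"
proof -
  let ?y = "f x"
  have "tracks \<lparr>nI = nI (S i), nL = nI (S i), nY = ipow (nY (S i)) m,
      nG = (real m *\<^sub>I ipow (nY (S i)) (m - 1)) *s nG (S i),
      nLam = step_Lam S (nI (S i)) (ipow (nY (S i)) m) (PowNatOp i m)\<rparr> (\<lambda>z. f z ^ m) x"
  proof (rule tracks_unary[OF f])
    show "\<forall>\<^sub>F s in nhds ?y. ((\<lambda>s. s ^ m) has_real_derivative real m * s ^ (m - 1)) (at s)"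
      by (intro always_eventually allI) (auto intro!: derivative_eq_intros)
    show "((\<lambda>s. real m * s ^ (m - 1)) has_real_derivative real (m * (m - 1)) * ?y ^ (m - 2)) (at ?y)"
      by (auto intro!: derivative_eq_intros simp: numeral_2_eq_2)
    show "?y ^ m \<in> set_of (ipow (nY (S i)) m)"
      "real m * ?y ^ (m - 1) \<in> set_of (real m *\<^sub>I ipow (nY (S i)) (m - 1))"
      using tracks_nY[OF f] by (auto intro: power_in_ipow scale_in_interval)
  next
    fix s assume s: "nL (S i) = UNIV" "s \<in> set_of (Lambda_s (- nI (S i)) (nG (S i)))"
    then show "real (m * (m - 1)) * ?y ^ (m - 2) * s
        \<in> set_of (step_Lam S (nI (S i)) (ipow (nY (S i)) m) (PowNatOp i m))"
      using tracks_nY[OF f]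
      by (simp add: Let_def times_in_intervalI scale_in_interval power_in_ipow del: of_nat_mult)
  next
    fix s \<mu> assume s: "nL (S i) \<noteq> UNIV" "s \<in> set_of (Lambda_s (- nI (S i)) (nG (S i)))"
      "\<mu> \<in> set_of (lam_mu (S i) (nI (S i)))"
    have "m - 1 = Suc (m - 2)"
      using \<open>2 \<le> m\<close> by simp
    then have "?y ^ (m - 1) = ?y ^ (m - 2) * ?y"
      by (simp only: power_Suc2)
    then have "real (m * (m - 1)) * ?y ^ (m - 2) * s + real m * ?y ^ (m - 1) * \<mu>
        = (real m * ?y ^ (m - 2)) * (real (m - 1) * s + ?y * \<mu>)"
      by (simp only: of_nat_mult distrib_left mult_ac)
    moreover have "\<dots> \<in> set_of (step_Lam S (nI (S i)) (ipow (nY (S i)) m) (PowNatOp i m))"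
      using tracks_nY[OF f] s
      by (simp add: Let_def times_in_intervalI scale_in_interval power_in_ipow plus_in_intervalI)
    ultimately show "real (m * (m - 1)) * ?y ^ (m - 2) * s + real m * ?y ^ (m - 1) * \<mu>
        \<in> set_of (step_Lam S (nI (S i)) (ipow (nY (S i)) m) (PowNatOp i m))"
      by simp
  qed
  then show ?thesis by (simp add: step_node_def Let_def)
qed

lemma tracks_oneOver:
  assumes f: "tracks (S i) f x" and "0 \<notin> set_of (nY (S i))"
  shows "tracks (step_node S (OneOverOp i)) (\<lambda>z. 1 / f z) x"
proof -
  let ?y = "f x" and ?Y = "iinv (nY (S i))"
  have y: "?y \<noteq> 0" and r: "1 / ?y \<in> set_of ?Y"
    using tracks_nY[OF f] assms(2) by (auto intro: inverse_in_iinv)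
  have r2: "(1 / ?y)\<^sup>2 \<in> set_of (ipow ?Y 2)" and r3: "(1 / ?y) ^ 3 \<in> set_of (ipow ?Y 3)"
    using r by (auto intro: power_in_ipow)
  have "tracks \<lparr>nI = nI (S i), nL = nI (S i), nY = ?Y,
      nG = (- ipow ?Y 2) *s nG (S i),
      nLam = step_Lam S (nI (S i)) ?Y (OneOverOp i)\<rparr> (\<lambda>z. 1 / f z) x"
  proof (rule tracks_unary[OF f])
    have "\<forall>\<^sub>F s in nhds ?y. s \<noteq> 0"
      using y by (rule t1_space_nhds)
    then show "\<forall>\<^sub>F s in nhds ?y. ((\<lambda>s. 1 / s) has_real_derivative - ((1 / s)\<^sup>2)) (at s)"
      by eventually_elim (auto intro!: derivative_eq_intros simp: power2_eq_square)
    show "((\<lambda>s. - ((1 / s)\<^sup>2)) has_real_derivative 2 * (1 / ?y) ^ 3) (at ?y)"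
      using y by (auto intro!: derivative_eq_intros simp: power2_eq_square power3_eq_cube)
    show "1 / ?y \<in> set_of ?Y" by (rule r)
    show "- ((1 / ?y)\<^sup>2) \<in> set_of (- ipow ?Y 2)" using r2 by (rule uminus_in_intervalI)
  next
    fix s assume s: "nL (S i) = UNIV" "s \<in> set_of (Lambda_s (- nI (S i)) (nG (S i)))"
    then show "2 * (1 / ?y) ^ 3 * s \<in> set_of (step_Lam S (nI (S i)) ?Y (OneOverOp i))"
      using times_in_intervalI[OF scale_in_interval[OF r3, of 2] s(2)] by (simp add: Let_def)
  next
    fix s \<mu> assume s: "nL (S i) \<noteq> UNIV" "s \<in> set_of (Lambda_s (- nI (S i)) (nG (S i)))"
      "\<mu> \<in> set_of (lam_mu (S i) (nI (S i)))"
    have "2 * (1 / ?y) ^ 3 * s + - ((1 / ?y)\<^sup>2) * \<mu> = (1 / ?y)\<^sup>2 * (2 * (1 / ?y) * s - \<mu>)"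
      by (simp add: algebra_simps power2_eq_square power3_eq_cube)
    also have "\<dots> \<in> set_of (ipow ?Y 2 * (2 *\<^sub>I ?Y * Lambda_s (- nI (S i)) (nG (S i)) - lam_mu (S i) (nI (S i))))"
      by (intro times_in_intervalI minus_in_intervalI r2 s) (simp_all add: r)
    finally show "2 * (1 / ?y) ^ 3 * s + - ((1 / ?y)\<^sup>2) * \<mu> \<in> set_of (step_Lam S (nI (S i)) ?Y (OneOverOp i))"
      using s by (simp only: step_Lam.simps Let_def if_False)
  qed
  then show ?thesis by (simp add: step_node_def Let_def)
qed

lemma tracks_sqrt:
  assumes f: "tracks (S i) f x" and "0 \<le> lower (nY (S i))" "0 \<notin> set_of (isqrt (nY (S i)))"
  shows "tracks (step_node S (SqrtOp i)) (\<lambda>z. sqrt (f z)) x"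
proof -
  let ?y = "f x" and ?Y = "isqrt (nY (S i))"
  let ?D = "iinv (2 *\<^sub>I ?Y)"
  have lo: "0 < lower (nY (S i))" "0 < lower ?Y"
    using lower_isqrt_pos assms(2,3) by auto
  have yY: "?y \<in> set_of (nY (S i))" by (rule tracks_nY[OF f])
  then have y: "0 < ?y" using lo by (auto simp: set_of_eq)
  have r: "sqrt ?y \<in> set_of ?Y" using yY by (rule sqrt_in_isqrt)
  have d1: "1 / (2 * sqrt ?y) \<in> set_of ?D"
    using r lo by (intro inverse_in_iinv scale_in_interval zero_notin_scaled zero_notin_pos) auto
  have d2: "1 / ((- 4) * sqrt ?y ^ 3) \<in> set_of (iinv ((- 4) *\<^sub>I ipow ?Y 3))"
    using r lo by (intro inverse_in_iinv scale_in_interval power_in_ipow zero_notin_scaled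
      zero_notin_pos lower_ipow_pos) auto
  have d3: "1 / ((- 2) * ?y) \<in> set_of (iinv ((- 2) *\<^sub>I nY (S i)))"
    using yY lo by (intro inverse_in_iinv scale_in_interval zero_notin_scaled zero_notin_pos) auto
  have "tracks \<lparr>nI = nI (S i), nL = nI (S i), nY = ?Y,
      nG = ?D *s nG (S i),
      nLam = step_Lam S (nI (S i)) ?Y (SqrtOp i)\<rparr> (\<lambda>z. sqrt (f z)) x"
  proof (rule tracks_unary[OF f])
    have "\<forall>\<^sub>F s in nhds ?y. 0 < s"
      using eventually_nhds_in_open[of "{0<..}" ?y] y by simp
    then show "\<forall>\<^sub>F s in nhds ?y. (sqrt has_real_derivative 1 / (2 * sqrt s)) (at s)"
      by eventually_elim (auto intro!: derivative_eq_intros simp: field_simps)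
    show "((\<lambda>s. 1 / (2 * sqrt s)) has_real_derivative 1 / ((- 4) * sqrt ?y ^ 3)) (at ?y)"
      using y by (auto intro!: derivative_eq_intros simp: power3_eq_cube field_simps)
    show "sqrt ?y \<in> set_of ?Y" "1 / (2 * sqrt ?y) \<in> set_of ?D" by (fact r d1)+
  next
    fix s assume s: "nL (S i) = UNIV" "s \<in> set_of (Lambda_s (- nI (S i)) (nG (S i)))"
    then show "1 / ((- 4) * sqrt ?y ^ 3) * s \<in> set_of (step_Lam S (nI (S i)) ?Y (SqrtOp i))"
      using times_in_intervalI[OF d2 s(2)] by (simp add: Let_def)
  next
    fix s \<mu> assume s: "nL (S i) \<noteq> UNIV" "s \<in> set_of (Lambda_s (- nI (S i)) (nG (S i)))"
      "\<mu> \<in> set_of (lam_mu (S i) (nI (S i)))"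
    have "sqrt ?y * sqrt ?y = ?y" using y by simp
    then have "1 / ((- 4) * sqrt ?y ^ 3) = 1 / (2 * sqrt ?y) * (1 / ((- 2) * ?y))"
      using y by (simp add: power3_eq_cube)
    then have "1 / ((- 4) * sqrt ?y ^ 3) * s + 1 / (2 * sqrt ?y) * \<mu>
        = 1 / (2 * sqrt ?y) * (1 / ((- 2) * ?y) * s + \<mu>)"
      by (simp only: distrib_left mult.assoc)
    also have "\<dots> \<in> set_of (?D * (iinv ((- 2) *\<^sub>I nY (S i)) * Lambda_s (- nI (S i)) (nG (S i)) + lam_mu (S i) (nI (S i))))"
      by (intro times_in_intervalI plus_in_intervalI d1 d3 s)
    finally show "1 / ((- 4) * sqrt ?y ^ 3) * s + 1 / (2 * sqrt ?y) * \<mu>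
        \<in> set_of (step_Lam S (nI (S i)) ?Y (SqrtOp i))"
      using s by (simp only: step_Lam.simps Let_def if_False)
  qed
  then show ?thesis by (simp add: step_node_def Let_def)
qed

lemma tracks_exp:
  assumes f: "tracks (S i) f x"
  shows "tracks (step_node S (ExpOp i)) (\<lambda>z. exp (f z)) x"
proof -
  let ?y = "f x" and ?Y = "iexp (nY (S i))"
  have r: "exp ?y \<in> set_of ?Y" by (intro exp_in_iexp tracks_nY[OF f])
  have "tracks \<lparr>nI = nI (S i), nL = nI (S i), nY = ?Y, nG = ?Y *s nG (S i),
      nLam = step_Lam S (nI (S i)) ?Y (ExpOp i)\<rparr> (\<lambda>z. exp (f z)) x"
  proof (rule tracks_unary[OF f])
    show "\<forall>\<^sub>F s in nhds ?y. (exp has_real_derivative exp s) (at s)"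
      by (intro always_eventually allI DERIV_exp)
    show "(exp has_real_derivative exp ?y) (at ?y)" by (rule DERIV_exp)
    show "exp ?y \<in> set_of ?Y" "exp ?y \<in> set_of ?Y" by (fact r)+
  next
    fix s assume s: "nL (S i) = UNIV" "s \<in> set_of (Lambda_s (- nI (S i)) (nG (S i)))"
    then show "exp ?y * s \<in> set_of (step_Lam S (nI (S i)) ?Y (ExpOp i))"
      using times_in_intervalI[OF r s(2)] by (simp add: Let_def)
  next
    fix s \<mu> assume s: "nL (S i) \<noteq> UNIV" "s \<in> set_of (Lambda_s (- nI (S i)) (nG (S i)))"
      "\<mu> \<in> set_of (lam_mu (S i) (nI (S i)))"
    then show "exp ?y * s + exp ?y * \<mu> \<in> set_of (step_Lam S (nI (S i)) ?Y (ExpOp i))"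
      using times_in_intervalI[OF r plus_in_intervalI[OF s(2,3)]] by (simp add: Let_def distrib_left)
  qed
  then show ?thesis by (simp add: step_node_def Let_def)
qed

lemma tracks_ln:
  assumes f: "tracks (S i) f x" and lo: "0 < lower (nY (S i))"
  shows "tracks (step_node S (LnOp i)) (\<lambda>z. ln (f z)) x"
proof -
  let ?y = "f x" and ?Y = "iln (nY (S i))" and ?D = "iinv (nY (S i))"
  have yY: "?y \<in> set_of (nY (S i))" by (rule tracks_nY[OF f])
  then have y: "0 < ?y" using lo by (auto simp: set_of_eq)
  have d1: "1 / ?y \<in> set_of ?D"
    using yY lo by (intro inverse_in_iinv zero_notin_pos)
  have d2: "- (1 / ?y\<^sup>2) \<in> set_of (- iinv (ipow (nY (S i)) 2))"
    using yY lo by (intro uminus_in_intervalI inverse_in_iinv power_in_ipow zero_notin_pos lower_ipow_pos)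
  have "tracks \<lparr>nI = nI (S i), nL = nI (S i), nY = ?Y, nG = ?D *s nG (S i),
      nLam = step_Lam S (nI (S i)) ?Y (LnOp i)\<rparr> (\<lambda>z. ln (f z)) x"
  proof (rule tracks_unary[OF f])
    have "\<forall>\<^sub>F s in nhds ?y. 0 < s"
      using eventually_nhds_in_open[of "{0<..}" ?y] y by simp
    then show "\<forall>\<^sub>F s in nhds ?y. (ln has_real_derivative 1 / s) (at s)"
      by eventually_elim (auto intro!: derivative_eq_intros)
    show "((\<lambda>s. 1 / s) has_real_derivative - (1 / ?y\<^sup>2)) (at ?y)"
      using y by (auto intro!: derivative_eq_intros simp: power2_eq_square)
    show "ln ?y \<in> set_of ?Y" using yY lo by (rule ln_in_iln)
    show "1 / ?y \<in> set_of ?D" by (rule d1)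
  next
    fix s assume s: "nL (S i) = UNIV" "s \<in> set_of (Lambda_s (- nI (S i)) (nG (S i)))"
    then show "- (1 / ?y\<^sup>2) * s \<in> set_of (step_Lam S (nI (S i)) ?Y (LnOp i))"
      using times_in_intervalI[OF d2 s(2)] by (simp add: Let_def)
  next
    fix s \<mu> assume s: "nL (S i) \<noteq> UNIV" "s \<in> set_of (Lambda_s (- nI (S i)) (nG (S i)))"
      "\<mu> \<in> set_of (lam_mu (S i) (nI (S i)))"
    have "- (1 / ?y\<^sup>2) * s + 1 / ?y * \<mu> = 1 / ?y * (\<mu> - 1 / ?y * s)"
      by (simp add: algebra_simps power2_eq_square)
    also have "\<dots> \<in> set_of (?D * (lam_mu (S i) (nI (S i)) - ?D * Lambda_s (- nI (S i)) (nG (S i))))"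
      by (intro times_in_intervalI minus_in_intervalI d1 s)
    finally show "- (1 / ?y\<^sup>2) * s + 1 / ?y * \<mu> \<in> set_of (step_Lam S (nI (S i)) ?Y (LnOp i))"
      using s by (simp only: step_Lam.simps Let_def if_False)
  qed
  then show ?thesis by (simp add: step_node_def Let_def)
qed

lemma tracks_add:
  "tracks (S i) f x \<Longrightarrow> tracks (S j) f' x \<Longrightarrow> tracks (step_node S (AddOp i j)) (\<lambda>z. f z + f' z) x"
  unfolding tracks_def by (blast intro: has_jet2_add encloses_add)

lemma tracks_mul:
  "tracks (S i) f x \<Longrightarrow> tracks (S j) f' x \<Longrightarrow> tracks (step_node S (MulOp i j)) (\<lambda>z. f z * f' z) x"
  unfolding tracks_def by (blast intro: has_jet2_mult encloses_mul)

lemma tracks_addC: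
  assumes "tracks (S i) f x"
  shows "tracks (step_node S (AddCOp i c)) (\<lambda>z. f z + c) x"
proof -
  from assms obtain g H where "has_jet2 f x g H" "encloses (S i) (f x) g H"
    by (auto simp: tracks_def)
  moreover from this(1) have "has_jet2 (\<lambda>z. f z + c) x (1 *\<^sub>R g) (\<lambda>v. 1 *\<^sub>R H v + (0 * (g \<bullet> v)) *\<^sub>R g)"
    by (rule has_jet2_compose[where \<phi> = "\<lambda>s. s + c" and \<phi>' = "\<lambda>_. 1"])
      (auto intro!: always_eventually derivative_eq_intros)
  ultimately show ?thesis
    unfolding tracks_def by (auto intro: encloses_addC)
qed

lemma tracks_mulByC:
  assumes "tracks (S i) f x"
  shows "tracks (step_node S (MulByCOp c i)) (\<lambda>z. c * f z) x"
proof -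
  from assms obtain g H where "has_jet2 f x g H" "encloses (S i) (f x) g H"
    by (auto simp: tracks_def)
  moreover from this(1) have "has_jet2 (\<lambda>z. c * f z) x (c *\<^sub>R g) (\<lambda>v. c *\<^sub>R H v + (0 * (g \<bullet> v)) *\<^sub>R g)"
    by (rule has_jet2_compose[where \<phi> = "\<lambda>s. c * s" and \<phi>' = "\<lambda>_. c"])
      (auto intro!: always_eventually derivative_eq_intros)
  ultimately show ?thesis
    unfolding tracks_def by (auto intro: encloses_mulByC)
qed

text \<open>
  The conditions for \<open>sqrt\<close> give \<open>y\<^sub>i > 0\<close> on the box, not just \<open>y\<^sub>i \<ge> 0\<close>, since \<open>0 \<notin> [y\<^sub>k]\<close>; hence
  every operation is twice differentiable where it is applied.
\<close>

lemma tracks_step_node: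
  assumes args: "\<And>i. i \<in> op_args p \<Longrightarrow> tracks (S i) (y i) x"
    and "op_wf k p" and "op_well_defined S k p" and Sk: "S k = step_node S p"
  shows "tracks (S k) (\<lambda>z. op_value (\<lambda>i. y i z) p) x"
proof (cases p)
  case (SqrtOp i)
  have "nY (S k) = isqrt (nY (S i))"
    using Sk SqrtOp by (simp add: step_node_def Let_def)
  then show ?thesis
    using assms SqrtOp by (auto intro: tracks_sqrt)
qed (use assms in \<open>auto simp: op_wf_def intro: tracks_add tracks_mul tracks_powNat tracks_oneOver
        tracks_exp tracks_ln tracks_addC tracks_mulByC\<close>)

section \<open>The algorithm\<close>

lemma step_node_cong:
  assumes "\<And>i. i \<in> op_args p \<Longrightarrow> S i = S' i"
  shows "step_node S p = step_node S' p"
  using assms by (cases p) (simp_all add: step_node_def)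

lemma algS_nodes_init: "k \<le> CARD('n) \<Longrightarrow> algS_nodes idx ops X s k = init_node idx X k"
  for X :: "real interval ^ 'n"
  by (induction s) (simp_all add: Let_def)

lemma algS_nodes_mono:
  fixes X :: "real interval ^ 'n"
  assumes "k \<le> CARD('n) + s" "s \<le> s'"
  shows "algS_nodes idx ops X s' k = algS_nodes idx ops X s k"
  using \<open>s \<le> s'\<close> by (induction rule: dec_induct) (use assms(1) in \<open>simp_all add: Let_def\<close>)

text \<open>
  A node only depends on earlier ones, which later steps leave unchanged; so the final table satisfies the
  recursion.
\<close>

lemma algS_nodes_step:
  fixes X :: "real interval ^ 'n"
  assumes k: "CARD('n) < k" "k \<le> CARD('n) + t" and wf: "op_wf k (ops k)"
  shows "algS_nodes idx ops X t k = step_node (algS_nodes idx ops X t) (ops k)"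
proof -
  define s where "s = k - CARD('n) - 1"
  have ks: "k = CARD('n) + Suc s" using k by (simp add: s_def)
  have "algS_nodes idx ops X t k = algS_nodes idx ops X (Suc s) k"
    using k ks by (intro algS_nodes_mono) auto
  also have "\<dots> = step_node (algS_nodes idx ops X s) (ops k)"
    by (simp add: Let_def ks)
  also have "\<dots> = step_node (algS_nodes idx ops X t) (ops k)"
  proof (rule step_node_cong)
    fix i assume "i \<in> op_args (ops k)"
    then have "i < k" using wf by (auto simp: op_wf_def)
    then show "algS_nodes idx ops X s i = algS_nodes idx ops X t i"
      using k ks by (intro algS_nodes_mono[symmetric]) auto
  qed
  finally show ?thesis .
qed

lemma tracks_cong:
  assumes "tracks P f x" "\<forall>\<^sub>F z in nhds x. f z = f' z"
  shows "tracks P f' x"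
  using assms has_jet2_cong eventually_nhds_x_imp_x[OF assms(2)] unfolding tracks_def by metis

text \<open>
  The codelist constrains its functions only on \<open>U\<close>; as \<open>U\<close> is open this determines
  their derivatives at \<open>x\<close>.
\<close>

lemma tracks_algS_nodes:
  fixes X :: "real interval ^ 'n"
  assumes U: "open U" "x \<in> U" and x: "x \<in> hyperrect X"
    and wf: "\<And>k. k \<in> {CARD('n) + 1..CARD('n) + t} \<Longrightarrow> op_wf k (ops k)"
    and var: "\<And>z k. z \<in> U \<Longrightarrow> k \<in> {1..CARD('n)} \<Longrightarrow> y k z = z $ idx k"
    and op: "\<And>z k. z \<in> U \<Longrightarrow> k \<in> {CARD('n) + 1..CARD('n) + t} \<Longrightarrow>
        y k z = op_value (\<lambda>i. y i z) (ops k)"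
    and wd: "algS_well_defined idx ops t X"
    and k: "1 \<le> k" "k \<le> CARD('n) + t"
  shows "tracks (algS_nodes idx ops X t k) (y k) x"
  using k
proof (induction k rule: less_induct)
  case (less k)
  have ev: "\<forall>\<^sub>F z in nhds x. z \<in> U"
    using U by (rule eventually_nhds_in_open)
  show ?case
  proof (cases "k \<le> CARD('n)")
    case True
    have "tracks (algS_nodes idx ops X t k) (\<lambda>z. z $ idx k) x"
      unfolding tracks_def algS_nodes_init[OF True]
      using has_jet2_component encloses_init_node[OF x] by blast
    then show ?thesis
      by (rule tracks_cong)
        (use ev in eventually_elim, use var less.prems True in auto)
  next
    case False
    then have k: "k \<in> {CARD('n) + 1..CARD('n) + t}" using less.prems by auto
    have "tracks (algS_nodes idx ops X t k) (\<lambda>z. op_value (\<lambda>i. y i z) (ops k)) x"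
    proof (rule tracks_step_node)
      show "op_wf k (ops k)" using k by (rule wf)
      then show "tracks (algS_nodes idx ops X t i) (y i) x" if "i \<in> op_args (ops k)" for i
        using that less.prems by (intro less.IH) (auto simp: op_wf_def)
      show "op_well_defined (algS_nodes idx ops X t) k (ops k)"
        using wd k by (simp add: algS_well_defined_def)
      show "algS_nodes idx ops X t k = step_node (algS_nodes idx ops X t) (ops k)"
        using k by (intro algS_nodes_step wf) auto
    qed
    then show ?thesis
      by (rule tracks_cong) (use ev in eventually_elim, use op k in auto)
  qed
qed

theorem proposition4p17:
  fixes \<phi> :: "real ^ 'n \<Rightarrow> real"
    and U :: "(real ^ 'n) set"
    and idx :: "nat \<Rightarrow> 'n"
    and ops :: "nat \<Rightarrow> operation"
    and t :: nat
    and X :: "real interval ^ 'n"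
    and \<Phi> \<Lambda> :: "real interval"
    and G :: "real interval ^ 'n"
  assumes "bij_betw idx {1..CARD('n)} UNIV"
    and "open U"
    and "C2_on U \<phi>"
    and "is_codelist idx ops t U \<phi>"
    and "hyperrect X \<subseteq> U"
    and "algS_well_defined idx ops t X"
    and "algS idx ops t X = (\<Phi>, G, \<Lambda>)"
  shows "\<forall>x\<in>hyperrect X.
           \<phi> x \<in> set_of \<Phi> \<and>
           grad \<phi> x \<in> hyperrect G \<and>
           {lambda_min (hessian \<phi> x)..lambda_max (hessian \<phi> x)} \<subseteq> set_of \<Lambda>"
proof
  fix x assume x: "x \<in> hyperrect X"
  then have "x \<in> U" using assms(5) by auto
  let ?N = "CARD('n) + t"
  obtain y :: "nat \<Rightarrow> real ^ 'n \<Rightarrow> real"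
    where wf: "\<And>k. k \<in> {CARD('n) + 1..?N} \<Longrightarrow> op_wf k (ops k)"
      and var: "\<And>z k. z \<in> U \<Longrightarrow> k \<in> {1..CARD('n)} \<Longrightarrow> y k z = z $ idx k"
      and op: "\<And>z k. z \<in> U \<Longrightarrow> k \<in> {CARD('n) + 1..?N} \<Longrightarrow> y k z = op_value (\<lambda>i. y i z) (ops k)"
      and \<phi>: "\<And>z. z \<in> U \<Longrightarrow> \<phi> z = y ?N z"
    using assms(4) unfolding is_codelist_def by metis
  define P where "P = algS_nodes idx ops X t ?N"
  have out: "\<Phi> = nY P" "G = nG P"
    "\<Lambda> = (if nL P = {} then nLam P else if nL P = UNIV then 0 else hull0 (nLam P))"
    using assms(7) unfolding algS_def Let_def P_def[symmetric] prod.inject by blast+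
  have "1 \<le> ?N" using zero_less_card_finite[where 'a = 'n] by linarith
  then have "tracks P (y ?N) x"
    unfolding P_def
    using tracks_algS_nodes[OF assms(2) \<open>x \<in> U\<close> x wf var op assms(6)] by simp
  moreover have "\<forall>\<^sub>F z in nhds x. y ?N z = \<phi> z"
    using eventually_nhds_in_open[OF assms(2) \<open>x \<in> U\<close>] by eventually_elim (simp add: \<phi>)
  ultimately have "tracks P \<phi> x"
    by (rule tracks_cong)
  then obtain g H where jet: "has_jet2 \<phi> x g H" and enc: "encloses P (\<phi> x) g H"
    by (auto simp: tracks_def)
  have hess: "hessian \<phi> x *v v = H v" for v
    using has_jet2_grad_hessian[OF jet] by simp
  have "{lambda_min (hessian \<phi> x)..lambda_max (hessian \<phi> x)} \<subseteq> set_of \<Lambda>"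
  proof (rule eigenvalue_range_subset)
    show "u \<bullet> (hessian \<phi> x *v v) = v \<bullet> (hessian \<phi> x *v u)" for u v
      using enc by (simp add: hess encloses_def)
    fix v
    have form: "in_multiple (v \<bullet> H v) (nLam P) (sqnorm_on (- nL P) v)"
      using enc by (simp add: encloses_def)
    have "in_multiple (v \<bullet> H v) \<Lambda> (sqnorm_on UNIV v)"
    proof (cases "nL P = {} \<or> nL P = UNIV")
      case True
      then show ?thesis
        using form by (auto simp: out in_multiple_def)
    next
      case False
      then show ?thesis
        using in_multiple_hull0[OF form sqnorm_on_nonneg sqnorm_on_mono[of "- nL P" UNIV v]]
        by (simp add: out)
    qed
    then show "in_multiple (v \<bullet> (hessian \<phi> x *v v)) \<Lambda> (v \<bullet> v)"
      by (simp add: hess sqnorm_on_UNIV)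
  qed
  then show "\<phi> x \<in> set_of \<Phi> \<and> grad \<phi> x \<in> hyperrect G \<and>
      {lambda_min (hessian \<phi> x)..lambda_max (hessian \<phi> x)} \<subseteq> set_of \<Lambda>"
    using enc has_jet2_grad_hessian(1)[OF jet] by (simp add: out encloses_def)
qed

end
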